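(* Let $r\ge 3$, let $e\ge 3$ be an odd integer, $q=2^e$, let $\mathcal{V}^r_\varepsilon\subset\mathrm{PG}(r,q^2)$ be the hypersurface defined in the context, and let $j\ge 1$ be an integer. Let $\overline{\mathcal{V}^r_\varepsilon}$ be the multiset of points of $\mathrm{PG}(r,q^2)$ consisting of the points of $\mathcal{V}^r_\varepsilon\setminus\Pi_\infty$ (each with multiplicity one) together with the point $P_\infty=(0,0,\dots,0,1)$ with multiplicity $j$. Then the linear code associated with $\overline{\mathcal{V}^r_\varepsilon}$ is a $[q^{2r-1}+j,\,r+1]_{q^2}$ code with (non-zero) weights $$q^{2r-1},\quad q^{2r-1}-q^{2r-3},\quad q^{2r-1}-q^{2r-3}+(-1)^{r-1}q^{r-2}+j,$$ $$q^{2r-1}-q^{2r-3}+(-1)^{r-1}q^{r-2}-(-1)^{r-1}q^{r-1}+j.$$ Furthermore, it is a $3$-weight code (i.e. it has exactly three distinct non-zero weights) in the following cases: (i) $r$ odd and $j=q^{r-1}-q^{r-2}$, or $j=q^{2r-3}-q^{r-2}$, or $j=q^{2r-3}+q^{r-1}-q^{r-2}$; (ii) $r$ even and $j=q^{r-2}$, or $j=q^{2r-3}+q^{r-2}$, or $j=q^{2r-3}-q^{r-1}+q^{r-2}$.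
   Context: Let $e\ge 3$ be odd, $q=2^e$, $r\ge 2$. Points of $\mathrm{PG}(r,q^2)$ (projective space of projective dimension $r$ over $\mathbb{F}_{q^2}$) have homogeneous coordinates $(X_0,\dots,X_r)$; $\Pi_\infty$ is the hyperplane $X_0=0$, and affine coordinates on the complement $\mathrm{AG}(r,q^2)$ are $x_i=X_i/X_0$. For an exponent involving $\sigma$, $\sigma$ stands for $2^{(e+1)/2}$, i.e. $x^{\sigma}=x^{2^{(e+1)/2}}$ and $x^{\sigma+2}=x^{2^{(e+1)/2}+2}$. Fix $\varepsilon\in\mathbb{F}_{q^2}\setminus\mathbb{F}_q$ such that $\varepsilon^2+\varepsilon+\delta=0$ for some $\delta\in\mathbb{F}_q\setminus\{1\}$ with absolute trace $\mathrm{Tr}_{q/2}(\delta)=\sum_{i=0}^{e-1}\delta^{2^i}=1$. Put $$\Gamma_{\varepsilon}(x)=[x+(x^q+x)\varepsilon]^{\sigma+2}+(x^q+x)^{\sigma}+(x^{2q}+x^2)\varepsilon+x^{q+1}+x^2.$$ $\mathcal{V}^r_\varepsilon$ is the projective hypersurface of $\mathrm{PG}(r,q^2)$ with affine equation $x_r^q+x_r=\Gamma_{\varepsilon}(x_1)+\dots+\Gamma_{\varepsilon}(x_{r-1})$, i.e. the zero locus of the homogenization (with respect to $X_0$) of the corresponding polynomial; it is identified with its set of $\mathbb{F}_{q^2}$-rational points. The linear code associated with a multiset of $N$ points (counted with multiplicity) of $\mathrm{PG}(r,q^2)$ is the linear code of length $N$ over $\mathbb{F}_{q^2}$ spanned by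 the rows of an $(r+1)\times N$ matrix whose columns are coordinate vectors of the points of the multiset, each point repeated according to its multiplicity; it is unique up to monomial equivalence. An $[N,k]_{q^2}$ code is a linear code over $\mathbb{F}_{q^2}$ of length $N$ and dimension $k$. Weights are Hamming weights of non-zero codewords. *)

theory Defs
  imports
    "HOL-Library.Cardinality"
    "HOL-Library.Multiset"
    "HOL-Library.Poly_Mapping"
    "Jordan_Normal_Form.VS_Connect"
begin

section \<open>Polynomials in the indeterminates \<open>X\<^sub>0, X\<^sub>1, \<dots>\<close>\<close>

text \<open>
  A polynomial maps each monomial (a finitely supported exponent vector) to its coefficient;
  the ring operations are those of the monoid algebra in \<^theory>\<open>HOL-Library.Poly_Mapping\<close>.
\<close>

type_synonym 'a polynomial = "(nat \<Rightarrow>\<^sub>0 nat) \<Rightarrow>\<^sub>0 'a"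

definition poly_var :: "nat \<Rightarrow> 'a::comm_ring_1 polynomial" where
  "poly_var i = Poly_Mapping.single (Poly_Mapping.single i 1) 1"

definition poly_const :: "'a \<Rightarrow> 'a::comm_ring_1 polynomial" where
  "poly_const c = Poly_Mapping.single 0 c"

definition monom_degree :: "(nat \<Rightarrow>\<^sub>0 nat) \<Rightarrow> nat" where
  "monom_degree m = (\<Sum>i\<in>Poly_Mapping.keys m. Poly_Mapping.lookup m i)"

definition poly_degree :: "'a::comm_ring_1 polynomial \<Rightarrow> nat" where
  "poly_degree p = Max (insert 0 (monom_degree ` Poly_Mapping.keys p))"

definition poly_eval :: "(nat \<Rightarrow> 'a) \<Rightarrow> 'a::comm_ring_1 polynomial \<Rightarrow> 'a" where
  "poly_eval a p = (\<Sum>m\<in>Poly_Mapping.keys p.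
     Poly_Mapping.lookup p m * (\<Prod>i\<in>Poly_Mapping.keys m. a i ^ Poly_Mapping.lookup m i))"

text \<open>Meant for polynomials in which \<open>X\<^sub>0\<close> does not occur; \<open>X\<^sub>0\<close> is the homogenizing variable.\<close>

definition homogenize :: "'a::comm_ring_1 polynomial \<Rightarrow> 'a polynomial" where
  "homogenize p = (\<Sum>m\<in>Poly_Mapping.keys p.
     Poly_Mapping.single (m + Poly_Mapping.single 0 (poly_degree p - monom_degree m))
       (Poly_Mapping.lookup p m))"

section \<open>The projective space \<open>PG(r, F)\<close> over a field\<close>

text \<open>A point is represented as the set of all its homogeneous coordinate vectors.\<close>

definition proj_point :: "'a::field vec \<Rightarrow> 'a vec set" where
  "proj_point v = {c \<cdot>\<^sub>v v | c. c \<noteq> 0}"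

definition PG :: "nat \<Rightarrow> 'a::field vec set set" where
  "PG r = {proj_point v | v. v \<in> carrier_vec (r + 1) \<and> v \<noteq> 0\<^sub>v (r + 1)}"

definition hyperplane_at_infinity :: "nat \<Rightarrow> 'a::field vec set set" where
  "hyperplane_at_infinity r = {P \<in> PG r. \<forall>X\<in>P. X $ 0 = 0}"

definition point_at_infinity :: "nat \<Rightarrow> 'a::field vec set" where
  "point_at_infinity r = proj_point (unit_vec (r + 1) r)"

definition zero_locus :: "nat \<Rightarrow> 'a::field polynomial \<Rightarrow> 'a vec set set" where
  "zero_locus r p = {P \<in> PG r. \<forall>X\<in>P. poly_eval (\<lambda>i. X $ i) p = 0}"

section \<open>The hypersurface\<close>

text \<open>The subfield of order \<open>q\<close> of a field of order \<open>q\<^sup>2\<close>\<close>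

definition subfield_of_order :: "nat \<Rightarrow> 'a::field set" where
  "subfield_of_order q = {x. x ^ q = x}"

definition abs_trace :: "nat \<Rightarrow> 'a::field \<Rightarrow> 'a" where
  "abs_trace e x = (\<Sum>i<e. x ^ (2 ^ i))"

text \<open>
  Stated over an arbitrary commutative ring so that it can be instantiated with polynomials.
  The exponent \<open>\<sigma>\<close> is meant for odd \<open>e\<close>, so that the division is exact.
\<close>

definition Gamma :: "nat \<Rightarrow> 'b::comm_ring_1 \<Rightarrow> 'b \<Rightarrow> 'b" where
  "Gamma e \<epsilon> x =
     (let q = 2 ^ e; \<sigma> = 2 ^ ((e + 1) div 2) in
      (x + (x ^ q + x) * \<epsilon>) ^ (\<sigma> + 2) + (x ^ q + x) ^ \<sigma>
        + (x ^ (2 * q) + x ^ 2) * \<epsilon> + x ^ (q + 1) + x ^ 2)"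

definition hypersurface_poly :: "nat \<Rightarrow> nat \<Rightarrow> 'a::comm_ring_1 \<Rightarrow> 'a polynomial" where
  "hypersurface_poly r e \<epsilon> =
     poly_var r ^ (2 ^ e) + poly_var r - (\<Sum>i = 1..r - 1. Gamma e (poly_const \<epsilon>) (poly_var i))"

definition hypersurface :: "nat \<Rightarrow> nat \<Rightarrow> 'a::field \<Rightarrow> 'a vec set set" where
  "hypersurface r e \<epsilon> = zero_locus r (homogenize (hypersurface_poly r e \<epsilon>))"

definition hypersurface_mset :: "nat \<Rightarrow> nat \<Rightarrow> 'a::{field,finite} \<Rightarrow> nat \<Rightarrow> 'a vec set multiset" where
  "hypersurface_mset r e \<epsilon> j =
     mset_set (hypersurface r e \<epsilon> - hyperplane_at_infinity r)
       + replicate_mset j (point_at_infinity r)"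

section \<open>Linear codes\<close>

definition linear_code :: "nat \<Rightarrow> nat \<Rightarrow> 'a::field vec set \<Rightarrow> bool" where
  "linear_code N k C \<longleftrightarrow>
     subspace class_ring C (module_vec TYPE('a) N) \<and>
     vectorspace.dim class_ring (module_vec TYPE('a) N\<lparr>carrier := C\<rparr>) = k"

definition hamming_weight :: "'a::zero vec \<Rightarrow> nat" where
  "hamming_weight v = card {i. i < dim_vec v \<and> v $ i \<noteq> 0}"

definition code_weights :: "'a::zero vec set \<Rightarrow> nat set" where
  "code_weights C = hamming_weight ` {c \<in> C. c \<noteq> 0\<^sub>v (dim_vec c)}"

text \<open>
  The code of a multiset \<open>M\<close> of points depends on the order of the points and on the choice of
  their coordinate vectors, hence it is only determined up to monomial equivalence and
  rendered as a relation.
\<close>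

definition associated_code :: "nat \<Rightarrow> 'a::field vec set multiset \<Rightarrow> 'a vec set \<Rightarrow> bool" where
  "associated_code r M C \<longleftrightarrow>
     (\<exists>ps G. mset ps = M \<and> G \<in> carrier_mat (r + 1) (length ps) \<and>
        (\<forall>i<length ps. col G i \<in> ps ! i) \<and>
        C = vec_space.row_space (length ps) G)"

lemma proj_point_self: "v \<in> proj_point v"
  unfolding proj_point_def by (auto intro: exI[of _ 1])

lemma associated_code_exists:
  assumes "set_mset M \<subseteq> PG r"
  shows "\<exists>C. associated_code r M C"
proof -
  obtain ps where ps: "mset ps = M"
    using ex_mset by blast
  have "\<exists>v. v \<in> P \<and> v \<in> carrier_vec (r + 1)" if "P \<in> set ps" for P
    using that assms ps proj_point_self unfolding PG_def by fastforce
  then obtain f where f: "\<And>P. P \<in> set ps \<Longrightarrow> f P \<in> P \<and> f P \<in> carrier_vec (r + 1)"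
    by metis
  let ?G = "mat_of_cols (r + 1) (map f ps)"
  have "\<forall>i<length ps. col ?G i \<in> ps ! i"
    using f by simp
  moreover have "?G \<in> carrier_mat (r + 1) (length ps)"
    using mat_of_cols_carrier(1)[of "r + 1" "map f ps"] by simp
  ultimately show ?thesis
    unfolding associated_code_def using ps by blast
qed

lemma hypersurface_mset_subset: "set_mset (hypersurface_mset r e \<epsilon> j) \<subseteq> PG r"
proof -
  have "point_at_infinity r \<in> (PG r :: 'a vec set set)"
    unfolding point_at_infinity_def PG_def
    by (auto intro!: exI[of _ "unit_vec (r + 1) r :: 'a vec"])
  moreover have "set_mset (mset_set A) \<subseteq> A" for A :: "'a vec set set"
    by (cases "finite A") auto
  ultimately show ?thesis
    unfolding hypersurface_mset_def hypersurface_def zero_locus_def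
    by (fastforce split: if_splits)
qed

end

theory Submission
  imports Defs "HOL-Number_Theory.Residues" "Jordan_Normal_Form.DL_Rank"
begin

text \<open>
  Write \<open>T(x) = x\<^sup>q + x\<close> and \<open>x = u + v \<epsilon>\<close> with \<open>u, v\<close> in the subfield \<open>K\<close> of order \<open>q\<close>; then
  \<open>\<Gamma>(x) = F(u, v)\<close> for the Lueneburg--Tits form \<open>F(u, v) = u\<^bsup>\<sigma>+2\<^esup> + u v + v\<^bsup>\<sigma>\<^esup>\<close>. Since \<open>F\<close> is homogeneous
  for a weighted scaling and has only the trivial zero, it takes the value \<open>0\<close> once and every other value
  of \<open>K\<close> exactly \<open>q + 1\<close> times. A Suzuki translation absorbs a linear form \<open>T(m x)\<close> into an additive
  constant, so \<open>\<Gamma>(x) + T(m x)\<close> has the same value distribution up to a shift. The distribution of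
  \<open>\<Sum>\<^sub>i \<Gamma>(x\<^sub>i) + T(m\<^sub>i x\<^sub>i)\<close> follows by induction on the number of summands, and it counts the
  affine points on a hyperplane whose equation involves \<open>X\<^sub>r\<close>; the other hyperplanes are unions of fibres of
  \<open>T\<close>. The weight of a codeword is the
  number of affine points off the corresponding hyperplane, plus \<open>j\<close> if the equation involves \<open>X\<^sub>r\<close>.
\<close>

section \<open>Evaluation of polynomials\<close>

definition monom_eval :: "(nat \<Rightarrow> 'a::comm_ring_1) \<Rightarrow> (nat \<Rightarrow>\<^sub>0 nat) \<Rightarrow> 'a" where
  "monom_eval a m = (\<Prod>i\<in>Poly_Mapping.keys m. a i ^ Poly_Mapping.lookup m i)"

text \<open>Lets two monomials be evaluated over a common index set, on which their exponents add
  pointwise; their own key sets differ in general.\<close>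

lemma monom_eval_superset:
  assumes "finite I" "Poly_Mapping.keys m \<subseteq> I"
  shows "monom_eval a m = (\<Prod>i\<in>I. a i ^ Poly_Mapping.lookup m i)"
  unfolding monom_eval_def
  using assms by (intro prod.mono_neutral_left) (auto simp: in_keys_iff)

lemma monom_eval_add: "monom_eval a (m + n) = monom_eval a m * monom_eval a n"
proof -
  let ?I = "Poly_Mapping.keys m \<union> Poly_Mapping.keys n"
  have "Poly_Mapping.keys (m + n) \<subseteq> ?I"
    by (rule keys_add)
  then show ?thesis
    by (simp add: monom_eval_superset[of ?I] lookup_add power_add prod.distrib)
qed

lemma monom_eval_0 [simp]: "monom_eval a 0 = 1"
  by (simp add: monom_eval_def)

lemma monom_eval_single [simp]: "monom_eval a (Poly_Mapping.single i k) = a i ^ k"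
  by (simp add: monom_eval_def)

lemma monom_eval_scale: "monom_eval (\<lambda>i. c * a i) m = c ^ monom_degree m * monom_eval a m"
  by (simp add: monom_eval_def monom_degree_def power_mult_distrib prod.distrib power_sum)

lemma monom_degree_superset:
  assumes "finite I" "Poly_Mapping.keys m \<subseteq> I"
  shows "monom_degree m = (\<Sum>i\<in>I. Poly_Mapping.lookup m i)"
  unfolding monom_degree_def
  using assms by (intro sum.mono_neutral_left) (auto simp: in_keys_iff)

lemma monom_degree_add: "monom_degree (m + n) = monom_degree m + monom_degree n"
proof -
  let ?I = "Poly_Mapping.keys m \<union> Poly_Mapping.keys n"
  have "Poly_Mapping.keys (m + n) \<subseteq> ?I"
    by (rule keys_add)
  then show ?thesis
    by (simp add: monom_degree_superset[of ?I] lookup_add sum.distrib)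
qed

lemma monom_degree_single [simp]: "monom_degree (Poly_Mapping.single i k) = k"
  by (simp add: monom_degree_def)

lemma monom_degree_le_poly_degree:
  "m \<in> Poly_Mapping.keys p \<Longrightarrow> monom_degree m \<le> poly_degree p"
  by (simp add: poly_degree_def)

lemma poly_eval_monom_eval:
  "poly_eval a p = (\<Sum>m\<in>Poly_Mapping.keys p. Poly_Mapping.lookup p m * monom_eval a m)"
  by (simp add: poly_eval_def monom_eval_def)

lemma poly_eval_0 [simp]: "poly_eval a 0 = 0"
  by (simp add: poly_eval_def)

lemma poly_eval_single: "poly_eval a (Poly_Mapping.single m c) = c * monom_eval a m"
  by (simp add: poly_eval_monom_eval)

lemma poly_eval_1 [simp]: "poly_eval a 1 = 1"
  using poly_eval_single[of a 0 1] by simp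

lemma poly_eval_add [simp]: "poly_eval a (p + p') = poly_eval a p + poly_eval a p'"
  unfolding poly_eval_monom_eval
  by (rule setsum_keys_plus_distrib[where f = "\<lambda>m c. c * monom_eval a m"])
    (simp_all add: distrib_right)

lemma poly_eval_uminus [simp]: "poly_eval a (- p) = - poly_eval a p"
  using poly_eval_add[of a p "- p"] by (simp add: eq_neg_iff_add_eq_0 add.commute)

lemma poly_eval_diff [simp]: "poly_eval a (p - p') = poly_eval a p - poly_eval a p'"
  using poly_eval_add[of a p "- p'"] by simp

lemma poly_eval_sum [simp]: "poly_eval a (\<Sum>i\<in>I. p i) = (\<Sum>i\<in>I. poly_eval a (p i))"
  by (induction I rule: infinite_finite_induct) simp_all

text \<open>Reduces multiplicativity of \<open>poly_eval\<close> to products of single terms, where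
  it becomes \<open>monom_eval_add\<close>.\<close>

lemma polynomial_expansion:
  fixes p :: "'a::comm_ring_1 polynomial"
  shows "p = (\<Sum>m\<in>Poly_Mapping.keys p. Poly_Mapping.single m (Poly_Mapping.lookup p m))"
proof (rule poly_mapping_eqI)
  fix k
  have "(\<Sum>m\<in>Poly_Mapping.keys p. Poly_Mapping.lookup p m when m = k) = Poly_Mapping.lookup p k"
    by (cases "k \<in> Poly_Mapping.keys p") (auto simp: when_def in_keys_iff)
  then show "Poly_Mapping.lookup p k = Poly_Mapping.lookup
      (\<Sum>m\<in>Poly_Mapping.keys p. Poly_Mapping.single m (Poly_Mapping.lookup p m)) k"
    by (simp add: lookup_sum lookup_single)
qed

lemma poly_eval_mult [simp]: "poly_eval a (p * p') = poly_eval a p * poly_eval a p'"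
proof -
  have "p * p' = (\<Sum>m\<in>Poly_Mapping.keys p. \<Sum>n\<in>Poly_Mapping.keys p'.
      Poly_Mapping.single (m + n) (Poly_Mapping.lookup p m * Poly_Mapping.lookup p' n))"
    by (subst polynomial_expansion[of p], subst polynomial_expansion[of p'])
      (simp add: sum_product mult_single)
  then show ?thesis
    by (simp add: poly_eval_monom_eval[of a p] poly_eval_monom_eval[of a p'] sum_product
        poly_eval_single monom_eval_add mult_ac)
qed

lemma poly_eval_power [simp]: "poly_eval a (p ^ n) = poly_eval a p ^ n"
  by (induction n) simp_all

lemma poly_eval_var [simp]: "poly_eval a (poly_var i) = a i"
  by (simp add: poly_var_def poly_eval_single)

lemma poly_eval_const [simp]: "poly_eval a (poly_const c) = c"
  by (simp add: poly_const_def poly_eval_single)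

lemma poly_eval_Gamma: "poly_eval a (Gamma e p x) = Gamma e (poly_eval a p) (poly_eval a x)"
  by (simp add: Gamma_def Let_def)

lemma poly_eval_hypersurface_poly:
  "poly_eval a (hypersurface_poly r e \<epsilon>) =
     a r ^ (2 ^ e) + a r - (\<Sum>i = 1..r - 1. Gamma e \<epsilon> (a i))"
  by (simp add: hypersurface_poly_def poly_eval_Gamma)

lemma poly_eval_homogenize_affine:
  "a 0 = 1 \<Longrightarrow> poly_eval a (homogenize p) = poly_eval a p"
  by (simp add: homogenize_def poly_eval_single monom_eval_add poly_eval_monom_eval[of a p])

text \<open>The padding power of the homogenizing variable brings every term to degree exactly
  \<open>poly_degree p\<close>; the truncated subtraction in \<open>homogenize\<close> is exact
  because no monomial of \<open>p\<close> exceeds that degree.\<close>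

lemma poly_eval_homogenize_scale:
  "poly_eval (\<lambda>i. c * a i) (homogenize p) = c ^ poly_degree p * poly_eval a (homogenize p)"
  by (simp add: homogenize_def poly_eval_single monom_eval_scale monom_degree_add
      monom_degree_le_poly_degree sum_distrib_left mult_ac)

section \<open>Finite fields of even characteristic\<close>

text \<open>Multiplication by a nonzero \<open>x\<close> permutes the nonzero elements; comparing
  their product before and after shows that the power of \<open>x\<close> with exponent one less
  than the field order is 1.\<close>

lemma finite_field_power_card:
  fixes x :: "'a::{field,finite}"
  shows "x ^ CARD('a) = x"
proof (cases "x = 0")
  case False
  let ?P = "\<Prod>(UNIV - {0 :: 'a})"
  have "bij_betw ((*) x) (UNIV - {0}) (UNIV - {0})"
    by (rule bij_betwI[of _ _ _ "\<lambda>y. y / x"]) (use False in auto)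
  then have "?P = (\<Prod>y\<in>UNIV - {0}. x * y)"
    by (rule prod.reindex_bij_betw[symmetric])
  also have "\<dots> = x ^ card (UNIV - {0 :: 'a}) * ?P"
    by (simp add: prod.distrib)
  finally have "x ^ card (UNIV - {0 :: 'a}) = 1"
    by simp
  then show ?thesis
    using card_Suc_Diff1[of "UNIV :: 'a set" 0] by (metis UNIV_I finite mult.right_neutral power_Suc)
qed (simp add: finite_UNIV_card_ge_0)

lemma CHAR_2_if_CARD_power_2:
  assumes "CARD('a::{field,finite}) = 2 ^ n"
  shows "CHAR('a) = 2"
proof -
  have "prime CHAR('a)"
    by (intro prime_CHAR_semidom finite_imp_CHAR_pos) simp
  moreover have "CHAR('a) dvd 2 ^ n"
    using CHAR_dvd_CARD[where 'a = 'a] assms by simp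
  ultimately show ?thesis
    using prime_dvd_power primes_dvd_imp_eq two_is_prime_nat by blast
qed

text \<open>The fixed points are roots of X^k - X, whose leading term survives because k >= 2. This
  will bound \<open>K\<close> from above.\<close>

lemma card_fixed_power_le:
  assumes "k \<ge> 2"
  shows "card {x::'a::field. x ^ k = x} \<le> k"
proof -
  let ?p = "Polynomial.monom 1 k - Polynomial.monom 1 1 :: 'a poly"
  have "Polynomial.coeff ?p k = 1"
    using assms by simp
  then have "?p \<noteq> 0"
    by (metis coeff_0 zero_neq_one)
  then have "card {x. poly ?p x = 0} \<le> Polynomial.degree ?p"
    by (rule card_poly_roots_bound)
  also have "\<dots> \<le> k"
    using assms by (intro degree_diff_le degree_monom_le[THEN order_trans]) auto
  finally show ?thesis
    by (simp add: poly_monom)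
qed

section \<open>The quadratic extension of the field of order q: relative trace and Tits
  automorphism\<close>

locale quadratic_ext_char_2 =
  fixes e q :: nat and \<epsilon> \<delta> :: "'a::{field,finite}"
  assumes odd_e: "odd e" and q_def: "q = 2 ^ e" and card_UNIV: "CARD('a) = q ^ 2"
    and \<delta>_in_subfield: "\<delta> \<in> subfield_of_order q" and \<epsilon>_notin_subfield: "\<epsilon> \<notin> subfield_of_order q"
    and \<epsilon>_root: "\<epsilon> ^ 2 + \<epsilon> + \<delta> = 0"
begin

abbreviation K :: "'a set" where "K \<equiv> subfield_of_order q"

text \<open>On \<open>K\<close>, raising to this power is the Tits automorphism: applied twice it is
  squaring, see \<open>power_\<sigma>_\<sigma>\<close>.\<close>

definition \<sigma> :: nat where "\<sigma> = 2 ^ ((e + 1) div 2)"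

text \<open>The relative trace from the whole field onto \<open>K\<close>, in contrast to
  \<open>abs_trace\<close>.\<close>

definition tr :: "'a \<Rightarrow> 'a" where "tr x = x ^ q + x"

definition F :: "'a \<Rightarrow> 'a \<Rightarrow> 'a" where "F u v = u ^ (\<sigma> + 2) + u * v + v ^ \<sigma>"

lemma \<sigma>_pos [simp]: "\<sigma> > 0"
  by (simp add: \<sigma>_def)

lemma q_ge_2: "q \<ge> 2"
  using odd_e odd_pos[of e] self_le_power[of 2 e] by (simp add: q_def)

lemma CHAR_2: "CHAR('a) = 2"
  by (rule CHAR_2_if_CARD_power_2[of "e * 2"]) (simp add: card_UNIV q_def power_mult)

lemma two_eq_0 [simp]: "(2 :: 'a) = 0"
  using of_nat_CHAR[where 'a = 'a] by (simp add: CHAR_2)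

lemma add_self [simp]: "x + x = (0 :: 'a)"
  by (metis mult_2 mult_zero_left two_eq_0)

lemma add_self_left [simp]: "x + (x + y) = (y :: 'a)"
  by (simp flip: add.assoc)

text \<open>Characteristic 2: with differences turned into sums, terms cross an equation without a
  sign, as in \<open>add_eq_iff\<close>.\<close>

lemma diff_eq_add [simp]: "x - y = x + (y :: 'a)"
  by (simp add: diff_conv_add_uminus del: add_uminus_conv_diff)

lemma add_eq_iff: "x + y = z \<longleftrightarrow> x = z + (y :: 'a)"
  by (metis diff_eq_add diff_add_cancel add_self_left add.commute)

lemma eq_iff_add_eq_0: "x = y \<longleftrightarrow> x + y = (0 :: 'a)"
  by (simp add: add_eq_iff)

lemma frob_add: "(x + y :: 'a) ^ 2 ^ n = x ^ 2 ^ n + y ^ 2 ^ n"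
  by (rule freshmans_dream') (simp_all add: CHAR_2)

lemma frob_add_q: "(x + y :: 'a) ^ q = x ^ q + y ^ q"
  by (simp add: q_def frob_add)

lemma frob_add_\<sigma>: "(x + y :: 'a) ^ \<sigma> = x ^ \<sigma> + y ^ \<sigma>"
  by (simp add: \<sigma>_def frob_add)

lemma frob_add_2: "(x + y :: 'a)\<^sup>2 = x\<^sup>2 + y\<^sup>2"
  using frob_add[of x y 1] by simp

lemma power_q_q [simp]: "((x :: 'a) ^ q) ^ q = x"
  using finite_field_power_card[of x] by (simp add: card_UNIV power_mult power2_eq_square)

lemma power_commute_exponents: "((x :: 'a) ^ m) ^ n = (x ^ n) ^ m"
  by (simp add: mult.commute flip: power_mult)

lemma in_K_iff: "x \<in> K \<longleftrightarrow> x ^ q = x"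
  by (simp add: subfield_of_order_def)

lemma power_in_K: "x \<in> K \<Longrightarrow> x ^ n \<in> K"
  unfolding in_K_iff by (subst power_commute_exponents) simp

lemma tr_in_K: "tr x \<in> K"
  unfolding in_K_iff tr_def by (simp only: frob_add_q power_q_q add.commute)

lemma K_closed [simp, intro]:
  "0 \<in> K" "1 \<in> K" "x \<in> K \<Longrightarrow> y \<in> K \<Longrightarrow> x + y \<in> K" "x \<in> K \<Longrightarrow> y \<in> K \<Longrightarrow> x * y \<in> K"
  "x \<in> K \<Longrightarrow> x ^ n \<in> K" "x \<in> K \<Longrightarrow> inverse x \<in> K" "tr x \<in> K"
  using q_ge_2 power_in_K[of x n] tr_in_K[of x]
  by (simp_all add: in_K_iff frob_add_q power_mult_distrib power_inverse)

lemma sum_in_K [intro]: "(\<And>i. i \<in> I \<Longrightarrow> f i \<in> K) \<Longrightarrow> sum f I \<in> K"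
  by (induction I rule: infinite_finite_induct) auto

lemma tr_add: "tr (x + y) = tr x + tr y"
  by (simp add: tr_def frob_add_q add_ac)

lemma tr_sum: "tr (\<Sum>i\<in>I. f i) = (\<Sum>i\<in>I. tr (f i))"
  using q_ge_2 by (induction I rule: infinite_finite_induct) (simp_all add: tr_add, simp_all add: tr_def)

lemma tr_scale: "c \<in> K \<Longrightarrow> tr (c * x) = c * tr x"
  by (simp add: tr_def in_K_iff power_mult_distrib distrib_left)

lemma tr_eq_0_iff: "tr x = 0 \<longleftrightarrow> x \<in> K"
  by (simp add: tr_def in_K_iff add_eq_iff)

text \<open>The kernel of the additive map \<open>tr\<close> is \<open>K\<close>, so the fibre
  through \<open>y\<close> is the coset y + K.\<close>

lemma card_tr_fibre_image: "card {x. tr x = tr y} = card K"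
proof -
  have "bij_betw ((+) y) K {x. tr x = tr y}"
    by (rule bij_betwI[of _ _ _ "\<lambda>x. x - y"])
      (auto simp: tr_add simp flip: tr_eq_0_iff simp: add_ac)
  then show ?thesis
    by (rule bij_betw_same_card[symmetric])
qed

lemma card_range_tr_mult_card_K: "card (range tr) * card K = q\<^sup>2"
proof -
  have "q\<^sup>2 = card (\<Union>t\<in>range tr. {x. tr x = t})"
    by (simp flip: card_UNIV) (rule arg_cong[of _ _ card], auto)
  also have "\<dots> = (\<Sum>t\<in>range tr. card {x. tr x = t})"
    by (rule card_UN_disjoint) auto
  also have "\<dots> = (\<Sum>t\<in>range tr. card K)"
    by (intro sum.cong) (auto simp: card_tr_fibre_image)
  finally show ?thesis
    by simp
qed

text \<open>The root bound gives card K <= q. Conversely the image of \<open>tr\<close> lies in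
  \<open>K\<close>, so q^2 = card (range tr) * card K <= (card K)^2. Equality then also makes
  \<open>tr\<close> surjective onto \<open>K\<close>.\<close>

lemma card_K: "card K = q" and range_tr: "range tr = K"
proof -
  have sub: "range tr \<subseteq> K"
    by auto
  have "card K \<le> q"
    unfolding subfield_of_order_def by (rule card_fixed_power_le[OF q_ge_2])
  moreover have "q * q \<le> card K * card K"
    using card_range_tr_mult_card_K card_mono[OF _ sub] mult_le_mono1[of "card (range tr)" "card K" "card K"]
    by (simp add: power2_eq_square)
  ultimately show K: "card K = q"
    by (metis le_antisym mult_le_mono mult_le_cancel2 nat_mult_le_cancel_disj linorder_not_le mult_strict_mono' zero_le)
  have "card (range tr) = card K"
    using card_range_tr_mult_card_K q_ge_2 by (simp add: K power2_eq_square)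
  then show "range tr = K"
    using sub by (intro card_subset_eq) auto
qed

lemma card_tr_fibre: "t \<in> K \<Longrightarrow> card {x. tr x = t} = q"
  using range_tr card_tr_fibre_image card_K by (metis rangeE)

text \<open>Applying \<open>tr\<close> to \<epsilon>^2 + \<epsilon> = \<delta>, which lies in the
  kernel \<open>K\<close>, leaves only 0 and 1 for the trace of \<epsilon>; the value 0 would put
  \<epsilon> into \<open>K\<close>.\<close>

lemma tr_\<epsilon>: "tr \<epsilon> = 1"
proof -
  have "(tr \<epsilon>)\<^sup>2 + tr \<epsilon> = tr (\<epsilon>\<^sup>2 + \<epsilon>)"
    by (simp add: tr_def frob_add_2 frob_add_q add_ac flip: power_mult) (simp add: mult.commute)
  also have "\<dots> = 0"
    using \<epsilon>_root \<delta>_in_subfield by (simp add: tr_eq_0_iff add_eq_iff)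
  finally have "tr \<epsilon> * (tr \<epsilon> + 1) = 0"
    by (simp add: power2_eq_square distrib_left)
  moreover have "tr \<epsilon> \<noteq> 0"
    using \<epsilon>_notin_subfield by (simp add: tr_eq_0_iff)
  ultimately show ?thesis
    by (simp add: add_eq_iff)
qed

text \<open>For odd \<open>e\<close> the exponent of 2 in \<sigma> is exactly half of e + 1, so
  \<sigma>^2 = 2q, and raising to the power q is trivial on \<open>K\<close>.\<close>

lemma power_\<sigma>_\<sigma>: "x \<in> K \<Longrightarrow> (x ^ \<sigma>) ^ \<sigma> = x\<^sup>2"
proof -
  assume x: "x \<in> K"
  have "(e + 1) div 2 + (e + 1) div 2 = e + 1"
    using odd_e by presburger
  then have "\<sigma> * \<sigma> = q * 2"
    by (simp add: \<sigma>_def q_def flip: power_add)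
  then have "(x ^ \<sigma>) ^ \<sigma> = (x ^ q)\<^sup>2"
    by (simp flip: power_mult)
  then show "(x ^ \<sigma>) ^ \<sigma> = x\<^sup>2"
    using x by (simp add: in_K_iff)
qed

section \<open>The Lueneburg-Tits form and its value distribution\<close>

lemma F_in_K [intro]: "u \<in> K \<Longrightarrow> v \<in> K \<Longrightarrow> F u v \<in> K"
  by (auto simp: F_def)

text \<open>The two arguments are the coordinates of \<open>x\<close> with respect to the basis 1,
  \<epsilon>. The terms of \<open>Gamma\<close> after the first two powers collect to (tr x)^2
  \<epsilon> + x tr x, which is the product of these coordinates.\<close>

lemma Gamma_eq_F: "Gamma e \<epsilon> x = F (x + tr x * \<epsilon>) (tr x)"
proof -
  have "x ^ (2 * q) + x\<^sup>2 = (tr x)\<^sup>2"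
    by (simp add: tr_def frob_add_2 mult.commute[of 2] flip: power_mult)
  moreover have "x ^ (q + 1) + x\<^sup>2 = x * tr x"
    by (simp add: tr_def distrib_left power2_eq_square)
  moreover have "Gamma e \<epsilon> x = (x + tr x * \<epsilon>) ^ (\<sigma> + 2) + tr x ^ \<sigma>
      + (x ^ (2 * q) + x\<^sup>2) * \<epsilon> + (x ^ (q + 1) + x\<^sup>2)"
    unfolding Gamma_def Let_def tr_def q_def[symmetric] \<sigma>_def[symmetric] by (simp only: add.assoc)
  moreover have "(tr x)\<^sup>2 * \<epsilon> + x * tr x = (x + tr x * \<epsilon>) * tr x"
    by (simp add: power2_eq_square algebra_simps)
  ultimately show ?thesis
    by (simp only: F_def add.assoc) (simp only: add_ac)
qed

text \<open>Since \<epsilon> has trace 1, applying \<open>tr\<close> gives tr x + tr x = 0.\<close>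

lemma coordinate_in_K [simp]: "x + tr x * \<epsilon> \<in> K"
proof -
  have "tr (x + tr x * \<epsilon>) = 0"
    by (simp add: tr_add tr_scale tr_\<epsilon>)
  then show ?thesis
    by (simp only: tr_eq_0_iff)
qed

lemma Gamma_in_K: "Gamma e \<epsilon> x \<in> K"
  by (auto simp: Gamma_eq_F)

lemma tr_coordinates: "u \<in> K \<Longrightarrow> v \<in> K \<Longrightarrow> tr (u + v * \<epsilon>) = v"
  using tr_eq_0_iff by (simp add: tr_add tr_scale tr_\<epsilon>)

lemma bij_betw_coordinates: "bij_betw (\<lambda>x. (x + tr x * \<epsilon>, tr x)) UNIV (K \<times> K)"
  by (rule bij_betwI[of _ _ _ "\<lambda>(u, v). u + v * \<epsilon>"]) (auto simp: tr_coordinates add.assoc)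

text \<open>These maps are the translations of the Suzuki group: they turn \<open>F\<close> plus a linear form into \<open>F\<close> plus a constant.\<close>

lemma F_translate:
  assumes "a \<in> K"
  shows "F (u + a) (v + a ^ \<sigma> * u + b) = F u v + F a b + (b + a ^ (\<sigma> + 1)) * u + a * v"
proof -
  have "(v + a ^ \<sigma> * u + b) ^ \<sigma> = v ^ \<sigma> + a\<^sup>2 * u ^ \<sigma> + b ^ \<sigma>"
    using assms by (simp add: frob_add_\<sigma> power_mult_distrib power_\<sigma>_\<sigma>)
  moreover have "(u + a) ^ (\<sigma> + 2) = (u ^ \<sigma> + a ^ \<sigma>) * (u\<^sup>2 + a\<^sup>2)"
    by (simp only: power_add frob_add_\<sigma> frob_add_2)
  \<comment> \<open>The cross terms a^2 u^\<sigma> and a^\<sigma> u^2 each occur twice and cancel in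
    characteristic 2.\<close>
  ultimately show ?thesis
    by (simp add: F_def power_add algebra_simps power2_eq_square)
qed

text \<open>With weights 1 for \<open>u\<close> and \<sigma> + 1 for \<open>v\<close>, all three
  terms of \<open>F\<close> have weight \<sigma> + 2; for v^\<sigma> this holds because \<sigma>
  applied twice squares \<open>l\<close>.\<close>

lemma F_scale:
  assumes "l \<in> K"
  shows "F (l * u) (l ^ (\<sigma> + 1) * v) = l ^ (\<sigma> + 2) * F u v"
proof -
  have "(l ^ (\<sigma> + 1)) ^ \<sigma> = (l ^ \<sigma>) ^ \<sigma> * l ^ \<sigma>"
    by (simp only: power_add power_one_right power_mult_distrib)
  also have "\<dots> = l ^ (\<sigma> + 2)"
    using assms by (simp only: power_\<sigma>_\<sigma> power_add mult.commute)
  finally have "(l ^ (\<sigma> + 1) * v) ^ \<sigma> = l ^ (\<sigma> + 2) * v ^ \<sigma>"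
    by (simp only: power_mult_distrib)
  moreover have "(l * u) * (l ^ (\<sigma> + 1) * v) = l ^ (\<sigma> + 2) * (u * v)"
    by simp
  ultimately show ?thesis
    by (simp only: F_def power_mult_distrib[of l u] distrib_left)
qed

text \<open>Applying \<sigma> to l^(\<sigma>+2) = 1 gives l^2 (l^\<sigma>)^2 = 1, while squaring it
  gives that product times l^2. Hence l^2 = 1, and squaring is injective in characteristic
  2.\<close>

lemma power_\<sigma>_2_eq_1: "l \<in> K \<Longrightarrow> l ^ (\<sigma> + 2) = 1 \<Longrightarrow> l = 1"
proof -
  assume l: "l \<in> K" and eq: "l ^ (\<sigma> + 2) = 1"
  have "l \<noteq> 0"
    using eq by auto
  have "1 = (l ^ (\<sigma> + 2)) ^ \<sigma>"
    by (simp only: eq power_one)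
  also have "\<dots> = l\<^sup>2 * (l ^ \<sigma>)\<^sup>2"
    by (simp only: power_add power_mult_distrib power_\<sigma>_\<sigma>[OF l] power_commute_exponents[of l 2 \<sigma>])
  finally have "l\<^sup>2 * (l ^ \<sigma>)\<^sup>2 = l ^ (\<sigma> + 2) * l ^ (\<sigma> + 2)"
    by (simp only: eq mult_1)
  then have "l\<^sup>2 * (l ^ \<sigma>)\<^sup>2 * 1 = l\<^sup>2 * (l ^ \<sigma>)\<^sup>2 * l\<^sup>2"
    by (simp add: power_add power2_eq_square mult_ac)
  then have "l\<^sup>2 = 1"
    using \<open>l \<noteq> 0\<close> by simp
  then have "(l + 1)\<^sup>2 = 0"
    by (simp add: frob_add_2)
  then show "l = 1"
    by (simp add: add_eq_iff)
qed

text \<open>An injective self-map of the finite set K - {0} is onto; injectivity is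
  \<open>power_\<sigma>_2_eq_1\<close> applied to a quotient.\<close>

lemma ex_power_\<sigma>_2_eq:
  assumes t: "t \<in> K" "t \<noteq> 0"
  shows "\<exists>l\<in>K. l \<noteq> 0 \<and> l ^ (\<sigma> + 2) = t"
proof -
  have "inj_on (\<lambda>l. l ^ (\<sigma> + 2)) (K - {0})"
  proof (rule inj_onI)
    fix x y assume x: "x \<in> K - {0}" and y: "y \<in> K - {0}" and eq: "x ^ (\<sigma> + 2) = y ^ (\<sigma> + 2)"
    have "(x / y) ^ (\<sigma> + 2) = x ^ (\<sigma> + 2) / y ^ (\<sigma> + 2)"
      by (rule power_divide)
    also have "\<dots> = 1"
      unfolding eq by (rule divide_self) (use y in simp)
    finally have "(x / y) ^ (\<sigma> + 2) = 1" .
    moreover have "x / y \<in> K"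
      unfolding divide_inverse using x y by (intro K_closed) auto
    ultimately have "x / y = 1"
      using power_\<sigma>_2_eq_1 by blast
    then show "x = y"
      using y by simp
  qed
  then have "(\<lambda>l. l ^ (\<sigma> + 2)) ` (K - {0}) = K - {0}"
    by (intro endo_inj_surj) auto
  moreover have "t \<in> K - {0}"
    using t by simp
  ultimately have "t \<in> (\<lambda>l. l ^ (\<sigma> + 2)) ` (K - {0})"
    by (simp only:)
  then show ?thesis
    by blast
qed

text \<open>If u is nonzero, scaling reduces to F 1 w = 0, that is w^\<sigma> = w + 1. Applying
  \<sigma> again gives w^2 = w, but neither 0 nor 1 solves the equation. If u = 0, only v^\<sigma>
  remains.\<close>

lemma F_eq_0_iff:
  assumes "u \<in> K" "v \<in> K"
  shows "F u v = 0 \<longleftrightarrow> u = 0 \<and> v = 0"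
proof
  assume eq: "F u v = 0"
  have "u = 0"
  proof (rule ccontr)
    assume "u \<noteq> 0"
    define w where "w = inverse u ^ (\<sigma> + 1) * v"
    have w: "w \<in> K"
      using assms by (auto simp: w_def)
    have "F 1 w = F (inverse u * u) w"
      using \<open>u \<noteq> 0\<close> by simp
    also have "\<dots> = 0"
      using assms eq by (simp only: w_def F_scale K_closed) simp
    finally have "w ^ \<sigma> + (w + 1) = 0"
      by (simp add: F_def add_ac)
    then have "w ^ \<sigma> = 0 + (w + 1)"
      by (rule iffD1[OF add_eq_iff])
    then have "w ^ \<sigma> = w + 1"
      by simp
    then have "(w ^ \<sigma>) ^ \<sigma> = w + (1 + 1)"
      by (simp only: frob_add_\<sigma> power_one add.assoc)
    then have "w\<^sup>2 = w"
      by (simp only: power_\<sigma>_\<sigma>[OF w] add_self add_0_right)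
    then have "w = 0 \<or> w = 1"
      by (simp add: power2_eq_square)
    then show False
      using \<open>w ^ \<sigma> = w + 1\<close> by (auto simp: zero_power)
  qed
  then show "u = 0 \<and> v = 0"
    using eq by (simp add: F_def)
qed (simp add: F_def)

text \<open>Scaling matches the fibres over nonzero values with one another, so they share a size N,
  and q^2 = 1 + (q - 1) N forces N = q + 1.\<close>

lemma card_F_fibre:
  assumes "t \<in> K"
  shows "card {(u, v) \<in> K \<times> K. F u v = t} = (if t = 0 then 1 else q + 1)"
proof -
  define Z where "Z t = {(u, v) \<in> K \<times> K. F u v = t}" for t
  have "Z 0 = {(0, 0)}"
    by (auto simp: Z_def F_eq_0_iff)
  then have Z0: "card (Z 0) = 1"
    by simp
  have Z1: "card (Z t) = card (Z 1)" if "t \<in> K" "t \<noteq> 0" for t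
  proof -
    obtain l where l: "l \<in> K" "l \<noteq> 0" "l ^ (\<sigma> + 2) = t"
      using ex_power_\<sigma>_2_eq[OF \<open>t \<in> K\<close> \<open>t \<noteq> 0\<close>] by blast
    have il: "inverse l ^ (\<sigma> + 2) * t = 1"
      using l(2) by (simp only: flip: l(3) power_mult_distrib) simp
    have Fl: "F (l * u) (l ^ (\<sigma> + 1) * v) = t * F u v"
      "F (inverse l * u) (inverse l ^ (\<sigma> + 1) * v) = inverse l ^ (\<sigma> + 2) * F u v" for u v
      by (simp_all only: F_scale l K_closed)
    have "bij_betw (\<lambda>(u, v). (l * u, l ^ (\<sigma> + 1) * v)) (Z 1) (Z t)"
    proof (rule bij_betwI[of _ _ _ "\<lambda>(u, v). (inverse l * u, inverse l ^ (\<sigma> + 1) * v)"])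
      show "(\<lambda>(u, v). (l * u, l ^ (\<sigma> + 1) * v)) \<in> Z 1 \<rightarrow> Z t"
        using l(1) by (auto simp: Z_def Fl simp del: power_add power_Suc Suc_eq_plus1 add_Suc_right One_nat_def)
      show "(\<lambda>(u, v). (inverse l * u, inverse l ^ (\<sigma> + 1) * v)) \<in> Z t \<rightarrow> Z 1"
        using l(1) il by (auto simp: Z_def Fl simp del: power_add power_Suc Suc_eq_plus1 add_Suc_right One_nat_def)
    next
      have "inverse l ^ (\<sigma> + 1) * (l ^ (\<sigma> + 1) * v) = v" "l ^ (\<sigma> + 1) * (inverse l ^ (\<sigma> + 1) * v) = v" for v
        using l(2) by (simp_all only: mult.assoc[symmetric] power_mult_distrib[symmetric]) simp_all
      then show "(case case p of (u, v) \<Rightarrow> (l * u, l ^ (\<sigma> + 1) * v) of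
          (u, v) \<Rightarrow> (inverse l * u, inverse l ^ (\<sigma> + 1) * v)) = p"
        "(case case p of (u, v) \<Rightarrow> (inverse l * u, inverse l ^ (\<sigma> + 1) * v) of
          (u, v) \<Rightarrow> (l * u, l ^ (\<sigma> + 1) * v)) = p" for p
        using l(2) by (simp_all only: split_def fst_conv snd_conv) (simp_all flip: mult.assoc)
    qed
    then show ?thesis
      by (simp add: bij_betw_same_card)
  qed
  have "q\<^sup>2 = card (\<Union>t\<in>K. Z t)"
  proof -
    have "(\<Union>t\<in>K. Z t) = K \<times> K"
      by (auto simp: Z_def)
    then show ?thesis
      by (simp add: card_K power2_eq_square)
  qed
  also have "\<dots> = (\<Sum>t\<in>K. card (Z t))"
    by (rule card_UN_disjoint) (auto simp: Z_def)
  also have "\<dots> = 1 + (\<Sum>t\<in>K - {0}. card (Z t))"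
    by (subst sum.remove[of _ 0]) (auto simp: Z0)
  also have "(\<Sum>t\<in>K - {0}. card (Z t)) = (\<Sum>t\<in>K - {0}. card (Z 1))"
    by (rule sum.cong) (auto intro: Z1)
  also have "1 + \<dots> = 1 + (q - 1) * card (Z 1)"
    by (simp add: card_K)
  finally have "1 + (q - 1) * card (Z 1) = 1 + (q - 1) * (q + 1)"
    using q_ge_2 by (simp add: power2_eq_square algebra_simps)
  then have "(q - 1) * card (Z 1) = (q - 1) * (q + 1)"
    by (rule add_left_imp_eq)
  then have "card (Z 1) = q + 1"
    using q_ge_2 by (simp only: mult_cancel1) simp
  then show ?thesis
    using assms Z0 Z1 by (simp add: Z_def)
qed

text \<open>The exceptional value is \<open>F a b\<close> for the translation that produces the
  linear form; as \<open>m\<close> varies, only the position of this value changes.\<close>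

lemma card_Gamma_plus_linear_fibre:
  "\<exists>c\<in>K. \<forall>t\<in>K. card {x. Gamma e \<epsilon> x + tr (m * x) = t} = (if t = c then 1 else q + 1)"
proof -
  \<comment> \<open>In coordinates the linear form is tr m * u + tr (m * \<epsilon>) * v. The choice
    of \<open>a\<close> and \<open>b\<close> matches these coefficients with those in
    \<open>F_translate\<close>.\<close>
  define a where "a = tr (m * \<epsilon>)"
  define b where "b = tr m + a ^ (\<sigma> + 1)"
  have ab: "a \<in> K" "b \<in> K"
    by (auto simp: a_def b_def)
  have shift: "F (u + a) (v + a ^ \<sigma> * u + b) = F u v + tr (m * (u + v * \<epsilon>)) + F a b"
    if "u \<in> K" "v \<in> K" for u v
  proof -
    have "tr (m * (u + v * \<epsilon>)) = tr (u * m + v * (m * \<epsilon>))"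
      by (simp add: distrib_left mult_ac)
    also have "\<dots> = tr m * u + a * v"
      using that by (simp add: tr_add tr_scale a_def)
    finally have "tr (m * (u + v * \<epsilon>)) = tr m * u + a * v" .
    moreover have "b + a ^ (\<sigma> + 1) = tr m"
      by (simp add: b_def add.assoc)
    ultimately show ?thesis
      by (simp only: F_translate[OF ab(1)]) (simp only: add_ac)
  qed
  define \<phi> where "\<phi> x = (let u = x + tr x * \<epsilon>; v = tr x in (u + a, v + a ^ \<sigma> * u + b))" for x
  have \<phi>: "bij_betw \<phi> UNIV (K \<times> K)"
  proof -
    \<comment> \<open>The inverse first recovers the old first coordinate as u + a, so the shear
      term is taken at u + a; no signs arise.\<close>
    have "bij_betw (\<lambda>(u, v). (u + a, v + a ^ \<sigma> * u + b)) (K \<times> K) (K \<times> K)"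
      by (rule bij_betwI[of _ _ _ "\<lambda>(u, v). (u + a, v + a ^ \<sigma> * (u + a) + b)"])
        (use ab in \<open>auto simp: add_ac\<close>)
    from bij_betw_trans[OF bij_betw_coordinates this] show ?thesis
      by (simp add: comp_def Let_def \<phi>_def[abs_def])
  qed
  have F\<phi>: "case_prod F (\<phi> x) = Gamma e \<epsilon> x + tr (m * x) + F a b" for x
    using shift[of "x + tr x * \<epsilon>" "tr x"] by (simp add: Gamma_eq_F \<phi>_def Let_def add.assoc)
  have "card {x. Gamma e \<epsilon> x + tr (m * x) = t} = (if t = F a b then 1 else q + 1)"
    if "t \<in> K" for t
  proof -
    have "bij_betw \<phi> {x \<in> UNIV. Gamma e \<epsilon> x + tr (m * x) = t} {p \<in> K \<times> K. case_prod F p = t + F a b}"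
    proof -
      have "bij_betw \<phi> {x \<in> UNIV. case_prod F (\<phi> x) = t + F a b} {p \<in> K \<times> K. case_prod F p = t + F a b}"
        using \<phi> by (rule bij_betw_Collect) simp
      then show ?thesis
        by (simp only: F\<phi> add_right_cancel)
    qed
    then have "card {x. Gamma e \<epsilon> x + tr (m * x) = t} = card {(u, v) \<in> K \<times> K. F u v = t + F a b}"
      using bij_betw_same_card by (fastforce simp: Sigma_def intro: arg_cong[of _ _ card])
    also have "\<dots> = (if t + F a b = 0 then 1 else q + 1)"
      using that ab by (intro card_F_fibre) auto
    finally show ?thesis
      by (simp add: add_eq_iff)
  qed
  then show ?thesis
    using ab by blast
qed

end

section \<open>Counting affine points on hyperplanes\<close>

text \<open>Counts by fibring over the restriction of a function to \<open>I\<close>, which serves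
  both as an induction step and to single out one coordinate.\<close>

lemma card_PiE_insert:
  fixes I :: "'i set" and P :: "('i \<Rightarrow> 'b::finite) \<Rightarrow> bool"
  assumes "finite I" "i \<notin> I"
  shows "card {g \<in> insert i I \<rightarrow>\<^sub>E UNIV. P g} = (\<Sum>g\<in>I \<rightarrow>\<^sub>E UNIV. card {x. P (g(i := x))})"
proof -
  have "bij_betw (\<lambda>(g, x). g(i := x)) (SIGMA g:I \<rightarrow>\<^sub>E UNIV. {x. P (g(i := x))})
      {g \<in> insert i I \<rightarrow>\<^sub>E UNIV. P g}"
  \<comment> \<open>Extensional functions are \<open>undefined\<close> off their domain, so this
    update is the restriction to \<open>I\<close>.\<close>
  proof (rule bij_betwI[of _ _ _ "\<lambda>g. (g(i := undefined), g i)"])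
    show "(\<lambda>(g, x). g(i := x)) \<in> (SIGMA g:I \<rightarrow>\<^sub>E UNIV. {x. P (g(i := x))}) \<rightarrow>
        {g \<in> insert i I \<rightarrow>\<^sub>E UNIV. P g}"
      by (auto simp: PiE_def extensional_def)
    show "(\<lambda>g. (g(i := undefined), g i)) \<in> {g \<in> insert i I \<rightarrow>\<^sub>E UNIV. P g} \<rightarrow>
        (SIGMA g:I \<rightarrow>\<^sub>E UNIV. {x. P (g(i := x))})"
      by (auto simp: PiE_def extensional_def)
  qed (use assms in \<open>auto simp: PiE_def extensional_def fun_eq_iff\<close>)
  moreover have "finite (I \<rightarrow>\<^sub>E (UNIV :: 'b set))"
    using assms by (intro finite_PiE) auto
  ultimately show ?thesis
    by (simp add: bij_betw_same_card flip: card_SigmaI)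
qed

lemma sum_fun_upd_notin: "i \<notin> I \<Longrightarrow> (\<Sum>k\<in>I. f k ((g(i := x)) k)) = (\<Sum>k\<in>I. f k (g k))"
  by (intro sum.cong) auto

text \<open>The equation has a unique solution for the coordinate with nonzero coefficient, and the
  others are free.\<close>

lemma card_affine_hyperplane:
  fixes c :: "'i \<Rightarrow> 'b::{field,finite}"
  assumes "finite I" "i \<in> I" "c i \<noteq> 0"
  shows "card {g \<in> I \<rightarrow>\<^sub>E UNIV. b + (\<Sum>k\<in>I. c k * g k) = 0} = CARD('b) ^ (card I - 1)"
proof -
  define J where "J = I - {i}"
  have J: "finite J" "i \<notin> J" "I = insert i J"
    using assms by (auto simp: J_def)
  have "{x. b + (c i * x + (\<Sum>k\<in>J. c k * g k)) = 0} = {- (b + (\<Sum>k\<in>J. c k * g k)) / c i}" for g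
    using assms(3) by (auto simp: field_simps eq_neg_iff_add_eq_0)
  then have "card {g \<in> insert i J \<rightarrow>\<^sub>E UNIV. b + (\<Sum>k\<in>insert i J. c k * g k) = 0} = (\<Sum>g\<in>J \<rightarrow>\<^sub>E (UNIV :: 'b set). 1)"
    using J(1,2) by (simp add: card_PiE_insert sum_fun_upd_notin[of _ _ "\<lambda>k y. c k * y"] fun_upd_same del: fun_upd_apply)
  also have "\<dots> = CARD('b) ^ card J"
    using J(1) by (simp add: card_PiE)
  finally show ?thesis
    using J by simp
qed

section \<open>Value distribution of sums, and sections of the affine part by hyperplanes\<close>

context quadratic_ext_char_2
begin

text \<open>The factor q on the left avoids the exponents 2n - 1 and n - 1, which would be negative
  for n = 0, where the induction starts.\<close>

lemma card_sum_Gamma_plus_linear: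
  assumes "finite I"
  shows "\<exists>c\<in>K. \<forall>t\<in>K.
    int q * int (card {g \<in> I \<rightarrow>\<^sub>E UNIV. (\<Sum>i\<in>I. Gamma e \<epsilon> (g i) + tr (m i * g i)) = t}) =
      int q ^ (2 * card I) + (-1) ^ card I * ((if t = c then int q ^ (card I + 1) else 0) - int q ^ card I)"
  using assms
proof (induction I rule: finite_induct)
  case empty
  then show ?case
    by (auto intro!: bexI[of _ 0] simp: PiE_empty_domain Collect_conv_if)
next
  case (insert i I)
  define h where "h i x = Gamma e \<epsilon> x + tr (m i * x)" for i x
  define S where "S g = (\<Sum>k\<in>I. h k (g k))" for g
  have h_in_K: "h k x \<in> K" for k x
    using Gamma_in_K by (auto simp: h_def)
  have S_in_K: "S g \<in> K" for g
    using h_in_K by (auto simp: S_def)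
  let ?n = "card I"
  obtain c where c: "c \<in> K" and IH: "\<And>t. t \<in> K \<Longrightarrow>
      int q * int (card {g \<in> I \<rightarrow>\<^sub>E UNIV. S g = t}) =
      int q ^ (2 * ?n) + (-1) ^ ?n * ((if t = c then int q ^ (?n + 1) else 0) - int q ^ ?n)"
    using insert.IH unfolding S_def h_def by blast
  obtain d where d: "d \<in> K" "\<And>t. t \<in> K \<Longrightarrow> card {x. h i x = t} = (if t = d then 1 else q + 1)"
    using card_Gamma_plus_linear_fibre[of "m i"] unfolding h_def by blast
  have "int q * int (card {g \<in> insert i I \<rightarrow>\<^sub>E UNIV. (\<Sum>k\<in>insert i I. h k (g k)) = t}) =
      int q ^ (2 * card (insert i I)) + (-1) ^ card (insert i I) *
        ((if t = c + d then int q ^ (card (insert i I) + 1) else 0) - int q ^ card (insert i I))"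
    if t: "t \<in> K" for t
  proof -
    let ?D = "{g \<in> I \<rightarrow>\<^sub>E UNIV. S g = t + d}"
    have fin: "finite (I \<rightarrow>\<^sub>E (UNIV :: 'a set))"
      using insert.hyps(1) by (intro finite_PiE) auto
    have "card {g \<in> insert i I \<rightarrow>\<^sub>E UNIV. (\<Sum>k\<in>insert i I. h k (g k)) = t} =
        (\<Sum>g\<in>I \<rightarrow>\<^sub>E UNIV. card {x. h i x = t + S g})"
      using insert.hyps
      by (simp add: card_PiE_insert sum_fun_upd_notin[of _ _ h] S_def add_eq_iff fun_upd_same del: fun_upd_apply)
    also have "\<dots> = (\<Sum>g\<in>I \<rightarrow>\<^sub>E UNIV. if S g = t + d then 1 else q + 1)"
    proof (intro sum.cong refl)
      fix g
      have "t + S g = d \<longleftrightarrow> S g = t + d"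
        by (metis add_self_left add.commute)
      then show "card {x. h i x = t + S g} = (if S g = t + d then 1 else q + 1)"
        using d t S_in_K by simp
    qed
    finally have "int (card {g \<in> insert i I \<rightarrow>\<^sub>E UNIV. (\<Sum>k\<in>insert i I. h k (g k)) = t}) =
        int (\<Sum>g\<in>I \<rightarrow>\<^sub>E UNIV. if S g = t + d then 1 else q + 1)"
      by (rule arg_cong)
    \<comment> \<open>Each choice on \<open>I\<close> has q + 1 extensions, or 1 at the exceptional
      value. This yields the recursion N'(t) = (q + 1) q^(2n) - q N(t + d), so the sign alternates
      and the exceptional value moves to c + d.\<close>
    also have "\<dots> = (\<Sum>g\<in>I \<rightarrow>\<^sub>E UNIV. (int q + 1) - int q * (if S g = t + d then 1 else 0))"
      unfolding of_nat_sum by (rule sum.cong) auto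
    also have "\<dots> = (int q + 1) * int (card (I \<rightarrow>\<^sub>E (UNIV :: 'a set))) - int q * int (card ?D)"
      using fin unfolding sum_subtractf sum_distrib_left[symmetric] sum.inter_filter[OF fin, symmetric]
      by simp
    also have "card (I \<rightarrow>\<^sub>E (UNIV :: 'a set)) = q ^ (2 * ?n)"
      using insert.hyps(1) by (simp add: card_PiE card_UNIV power_mult)
    finally have "int q * int (card {g \<in> insert i I \<rightarrow>\<^sub>E UNIV. (\<Sum>k\<in>insert i I. h k (g k)) = t}) =
        int q * ((int q + 1) * int q ^ (2 * ?n) - int q * int (card ?D))"
      by simp
    also have "int q * int (card ?D) =
        int q ^ (2 * ?n) + (-1) ^ ?n * ((if t = c + d then int q ^ (?n + 1) else 0) - int q ^ ?n)"
      using IH[of "t + d"] t d(1) by (simp only: add_eq_iff[of t d c] K_closed)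
    finally show ?thesis
      using insert.hyps by (cases "t = c + d") (simp_all add: algebra_simps)
  qed
  then show ?case
    using c d(1) unfolding h_def by (intro bexI[of _ "c + d"]) auto
qed

text \<open>Affine coordinates start at index 1, since the coordinate 0 is normalized to 1. Writing
  the index set with \<open>insert r\<close> splits off the last coordinate for the fibre
  counts.\<close>

definition affine_solutions :: "nat \<Rightarrow> (nat \<Rightarrow> 'a) set" where
  "affine_solutions r =
    {g \<in> insert r {1..<r} \<rightarrow>\<^sub>E UNIV. tr (g r) = (\<Sum>k\<in>{1..<r}. Gamma e \<epsilon> (g k))}"

lemma finite_PiE_UNIV: "finite ({1..<r :: nat} \<rightarrow>\<^sub>E (UNIV :: 'a set))"
  by (intro finite_PiE) auto

lemma card_affine_solutions_filter:
  "card {g \<in> affine_solutions r. P g} =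
    (\<Sum>g\<in>{1..<r} \<rightarrow>\<^sub>E UNIV. card {x. tr x = (\<Sum>k\<in>{1..<r}. Gamma e \<epsilon> (g k)) \<and> P (g(r := x))})"
  using card_PiE_insert[of "{1..<r}" r "\<lambda>g. tr (g r) = (\<Sum>k\<in>{1..<r}. Gamma e \<epsilon> (g k)) \<and> P g"]
  by (simp add: affine_solutions_def conj_assoc
        sum_fun_upd_notin[of _ _ "\<lambda>k y. Gamma e \<epsilon> y"] fun_upd_same del: fun_upd_apply)

lemma card_affine_solutions:
  assumes "r \<ge> 1"
  shows "card (affine_solutions r) = q ^ (2 * r - 1)"
proof -
  have "card (affine_solutions r) = (\<Sum>g\<in>{1..<r} \<rightarrow>\<^sub>E (UNIV :: 'a set). q)"
    using card_affine_solutions_filter[of r "\<lambda>_. True"] Gamma_in_K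
    by (simp add: card_tr_fibre sum_in_K)
  also have "\<dots> = q ^ (2 * (r - 1) + 1)"
    by (simp add: card_PiE card_UNIV power_mult)
  also have "2 * (r - 1) + 1 = 2 * r - 1"
    using assms by simp
  finally show ?thesis .
qed

text \<open>The last coordinate does not occur in the equation, so every point of an affine
  hyperplane in r - 1 dimensions carries a full trace fibre of q solutions.\<close>

lemma card_affine_solutions_vertical:
  assumes "y r = 0" "i \<in> {1..<r}" "y i \<noteq> 0"
  shows "card {g \<in> affine_solutions r. y 0 + (\<Sum>k\<in>insert r {1..<r}. y k * g k) = 0} = q ^ (2 * r - 3)"
proof -
  have "card {g \<in> affine_solutions r. y 0 + (\<Sum>k\<in>insert r {1..<r}. y k * g k) = 0} =
      (\<Sum>g\<in>{1..<r} \<rightarrow>\<^sub>E UNIV. if y 0 + (\<Sum>k\<in>{1..<r}. y k * g k) = 0 then q else 0)"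
    unfolding card_affine_solutions_filter
  proof (rule sum.cong[OF refl])
    fix g
    have "(\<Sum>k\<in>insert r {1..<r}. y k * (g(r := x)) k) = (\<Sum>k\<in>{1..<r}. y k * g k)" for x
      using assms(1) by (simp add: sum_fun_upd_notin[of _ _ "\<lambda>k x. y k * x"] fun_upd_same del: fun_upd_apply)
    then show "card {x. tr x = (\<Sum>k\<in>{1..<r}. Gamma e \<epsilon> (g k)) \<and>
          y 0 + (\<Sum>k\<in>insert r {1..<r}. y k * (g(r := x)) k) = 0} =
        (if y 0 + (\<Sum>k\<in>{1..<r}. y k * g k) = 0 then q else 0)"
      using Gamma_in_K by (simp add: card_tr_fibre sum_in_K del: fun_upd_apply sum.insert)
  qed
  also have "\<dots> = q * card {g \<in> {1..<r} \<rightarrow>\<^sub>E UNIV. y 0 + (\<Sum>k\<in>{1..<r}. y k * g k) = 0}"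
    using finite_PiE_UNIV[of r] by (simp flip: sum.inter_filter)
  also have "card {g \<in> {1..<r} \<rightarrow>\<^sub>E UNIV. y 0 + (\<Sum>k\<in>{1..<r}. y k * g k) = 0} = CARD('a) ^ (r - 2)"
    using card_affine_hyperplane[of "{1..<r}" i y "y 0"] assms(2,3) by (simp add: numeral_2_eq_2)
  also have "q * CARD('a) ^ (r - 2) = q ^ (2 * (r - 2) + 1)"
    by (simp add: card_UNIV power_mult)
  also have "2 * (r - 2) + 1 = 2 * r - 3"
    using assms(2) by auto
  finally show ?thesis .
qed

text \<open>The hyperplane equation determines the last coordinate from the others. Substituting it
  into the trace leaves one condition, whose linear terms join the \<open>Gamma\<close> sum in
  characteristic 2.\<close>

lemma card_affine_solutions_oblique:
  assumes "y r \<noteq> 0"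
  shows "card {g \<in> affine_solutions r. y 0 + (\<Sum>k\<in>insert r {1..<r}. y k * g k) = 0} =
    card {g \<in> {1..<r} \<rightarrow>\<^sub>E UNIV. (\<Sum>k\<in>{1..<r}. Gamma e \<epsilon> (g k) + tr (y k / y r * g k)) = tr (y 0 / y r)}"
proof -
  have "card {g \<in> affine_solutions r. y 0 + (\<Sum>k\<in>insert r {1..<r}. y k * g k) = 0} =
      (\<Sum>g\<in>{1..<r} \<rightarrow>\<^sub>E UNIV.
        if (\<Sum>k\<in>{1..<r}. Gamma e \<epsilon> (g k) + tr (y k / y r * g k)) = tr (y 0 / y r) then 1 else 0)"
    unfolding card_affine_solutions_filter
  proof (rule sum.cong[OF refl])
    fix g
    define z where "z = y 0 / y r + (\<Sum>k\<in>{1..<r}. y k / y r * g k)"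
    have eq: "y 0 + (\<Sum>k\<in>insert r {1..<r}. y k * (g(r := x)) k) = y r * (z + x)" for x
    proof -
      have "(\<Sum>k\<in>insert r {1..<r}. y k * (g(r := x)) k) = y r * x + (\<Sum>k\<in>{1..<r}. y k * g k)"
        by (simp add: sum_fun_upd_notin[of _ _ "\<lambda>k x. y k * x"] fun_upd_same del: fun_upd_apply)
      then show ?thesis
        using assms by (simp add: z_def distrib_left sum_distrib_left add_ac)
    qed
    have iff: "y 0 + (\<Sum>k\<in>insert r {1..<r}. y k * (g(r := x)) k) = 0 \<longleftrightarrow> x = z" for x
      unfolding eq using assms by (auto simp: add_eq_iff)
    have "tr z + (\<Sum>k\<in>{1..<r}. Gamma e \<epsilon> (g k)) =
        tr (y 0 / y r) + (\<Sum>k\<in>{1..<r}. Gamma e \<epsilon> (g k) + tr (y k / y r * g k))"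
      by (simp add: z_def tr_add tr_sum sum.distrib add_ac)
    then have "tr z = (\<Sum>k\<in>{1..<r}. Gamma e \<epsilon> (g k)) \<longleftrightarrow>
        (\<Sum>k\<in>{1..<r}. Gamma e \<epsilon> (g k) + tr (y k / y r * g k)) = tr (y 0 / y r)"
      unfolding eq_iff_add_eq_0[of "tr z"] eq_iff_add_eq_0[of _ "tr (y 0 / y r)"] by (simp add: add_ac)
    then show "card {x. tr x = (\<Sum>k\<in>{1..<r}. Gamma e \<epsilon> (g k)) \<and>
          y 0 + (\<Sum>k\<in>insert r {1..<r}. y k * (g(r := x)) k) = 0} =
        (if (\<Sum>k\<in>{1..<r}. Gamma e \<epsilon> (g k) + tr (y k / y r * g k)) = tr (y 0 / y r) then 1 else 0)"
    proof -
      assume *: "tr z = (\<Sum>k\<in>{1..<r}. Gamma e \<epsilon> (g k)) \<longleftrightarrow>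
        (\<Sum>k\<in>{1..<r}. Gamma e \<epsilon> (g k) + tr (y k / y r * g k)) = tr (y 0 / y r)"
      have "{x. tr x = (\<Sum>k\<in>{1..<r}. Gamma e \<epsilon> (g k)) \<and> x = z} =
          (if tr z = (\<Sum>k\<in>{1..<r}. Gamma e \<epsilon> (g k)) then {z} else {})"
        by auto
      then show ?thesis
        unfolding iff by (simp only: *) simp
    qed
  qed
  then show ?thesis
    using finite_PiE_UNIV[of r] by (simp flip: sum.inter_filter)
qed

end

section \<open>The code\<close>

lemma poly_eval_homogenize:
  fixes a :: "nat \<Rightarrow> 'a::field"
  assumes "a 0 \<noteq> 0"
  shows "poly_eval a (homogenize p) = a 0 ^ poly_degree p * poly_eval (\<lambda>i. a i / a 0) p"
  using poly_eval_homogenize_scale[of "a 0" "\<lambda>i. a i / a 0" p] assms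
  by (simp add: poly_eval_homogenize_affine)

text \<open>A trivial kernel of the encoding map means that the k rows of \<open>G\<close> are
  independent.\<close>

lemma linear_code_row_space:
  fixes G :: "'a::field mat"
  assumes G: "G \<in> carrier_mat k N"
    and inj: "\<And>y. y \<in> carrier_vec k \<Longrightarrow> G\<^sup>T *\<^sub>v y = 0\<^sub>v N \<Longrightarrow> y = 0\<^sub>v k"
  shows "linear_code N k (vec_space.row_space N G)"
proof -
  interpret vec_space "TYPE('a)" N .
  have GT: "G\<^sup>T \<in> carrier_mat N k"
    using G by simp
  have S: "set (cols G\<^sup>T) \<subseteq> carrier_vec N"
    using cols_dim[of "G\<^sup>T"] G by auto
  \<comment> \<open>Independence is a property of the set of columns of the transpose, so
    repetitions must be excluded first: equal rows would put a difference of unit vectors into the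
    kernel.\<close>
  have dist: "distinct (cols G\<^sup>T)"
  proof (rule distinct_conv_nth[THEN iffD2], intro allI impI notI)
    fix i l assume il: "i < length (cols G\<^sup>T)" "l < length (cols G\<^sup>T)" "i \<noteq> l"
      and eq: "cols G\<^sup>T ! i = cols G\<^sup>T ! l"
    have il': "i < k" "l < k"
      using il G by auto
    let ?y = "unit_vec k i - unit_vec k l :: 'a vec"
    have "G\<^sup>T *\<^sub>v ?y = col G\<^sup>T i - col G\<^sup>T l"
      using GT il' by (intro eq_vecI) (simp_all add: mult_minus_distrib_mat_vec[OF GT])
    also have "\<dots> = 0\<^sub>v N"
      using eq GT il' by (simp add: cols_nth)
    finally have "?y = 0\<^sub>v k"
      by (intro inj) auto
    then have "?y $ i = 0\<^sub>v k $ i"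
      by simp
    then show False
      using il' \<open>i \<noteq> l\<close> by simp
  qed
  have "lin_indpt (set (cols G\<^sup>T))"
    using lin_depE[OF GT _ dist] inj by metis
  then have "rank G\<^sup>T = k"
    using lin_indpt_full_rank[OF GT dist] by simp
  moreover have "VectorSpace.subspace class_ring (span (set (cols G\<^sup>T))) V"
    using S by (intro span_is_subspace) simp
  ultimately show ?thesis
    unfolding linear_code_def row_space_eq_col_space_transpose col_space_def rank_def by simp
qed

text \<open>The message \<open>y\<close> acts as the equation of a hyperplane. Whether it vanishes
  at a point does not depend on the representative, so the choice of columns does not affect the
  weight.\<close>

lemma hamming_weight_codeword:
  fixes G :: "'a::field mat"
  assumes G: "G \<in> carrier_mat (r + 1) (length ps)" and col: "\<And>i. i < length ps \<Longrightarrow> col G i \<in> ps ! i"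
    and ps: "set ps \<subseteq> PG r" and y: "y \<in> carrier_vec (r + 1)"
  shows "hamming_weight (G\<^sup>T *\<^sub>v y) = size {#P \<in># mset ps. \<exists>X\<in>P. X \<bullet> y \<noteq> 0#}"
proof -
  have nz: "(G\<^sup>T *\<^sub>v y) $ i \<noteq> 0 \<longleftrightarrow> (\<exists>X\<in>ps ! i. X \<bullet> y \<noteq> 0)" if i: "i < length ps" for i
  proof -
    have "ps ! i \<in> PG r"
      using ps i by auto
    then obtain v where v: "ps ! i = proj_point v" "v \<in> carrier_vec (r + 1)"
      by (auto simp: PG_def)
    have *: "(X \<bullet> y \<noteq> 0) = (v \<bullet> y \<noteq> 0)" if "X \<in> ps ! i" for X
      using that v y by (auto simp: proj_point_def)
    have "(G\<^sup>T *\<^sub>v y) $ i = col G i \<bullet> y"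
      using G i by simp
    moreover have "(\<exists>X\<in>ps ! i. X \<bullet> y \<noteq> 0) = (\<exists>X\<in>ps ! i. v \<bullet> y \<noteq> 0)"
      by (rule bex_cong[OF refl *])
    ultimately show ?thesis
      using *[OF col[OF i]] col[OF i] by auto
  qed
  have dim: "dim_vec (G\<^sup>T *\<^sub>v y) = length ps"
    using G by simp
  have "{i. i < dim_vec (G\<^sup>T *\<^sub>v y) \<and> (G\<^sup>T *\<^sub>v y) $ i \<noteq> 0} =
      {i. i < length ps \<and> (\<exists>X\<in>ps ! i. X \<bullet> y \<noteq> 0)}"
    unfolding dim by (intro Collect_cong conj_cong refl nz)
  then show ?thesis
    unfolding hamming_weight_def
    by (simp add: length_filter_conv_card flip: mset_filter)
qed

section \<open>From affine solutions to projective points\<close>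

context quadratic_ext_char_2
begin

definition affine_point :: "nat \<Rightarrow> (nat \<Rightarrow> 'a) \<Rightarrow> 'a vec" where
  "affine_point r g = vec (r + 1) (\<lambda>i. if i = 0 then 1 else g i)"

lemma affine_point_carrier [simp]: "affine_point r g \<in> carrier_vec (r + 1)" "affine_point r g \<in> carrier_vec (Suc r)"
  by (simp_all add: affine_point_def)

lemma affine_point_index [simp]:
  "affine_point r g $ 0 = 1" "0 < i \<Longrightarrow> i \<le> r \<Longrightarrow> affine_point r g $ i = g i"
  by (simp_all add: affine_point_def)

lemma poly_eval_homogenize_hypersurface_poly:
  assumes r: "r \<ge> 1" and "a 0 \<noteq> 0"
  shows "poly_eval a (homogenize (hypersurface_poly r e \<epsilon>)) = 0 \<longleftrightarrow>
    restrict (\<lambda>i. a i / a 0) (insert r {1..<r}) \<in> affine_solutions r"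
proof -
  have "{1..r - 1} = {1..<r}"
    using r by auto
  then show ?thesis
    using assms by (simp add: poly_eval_homogenize poly_eval_hypersurface_poly affine_solutions_def tr_def
        add_eq_iff flip: q_def)
qed

text \<open>A point off the hyperplane at infinity has a representative with coordinate 0 equal to
  1, on which the homogenized polynomial takes the value of the affine one.\<close>

lemma affine_points_hypersurface:
  assumes r: "r \<ge> 1"
  shows "hypersurface r e \<epsilon> - hyperplane_at_infinity r =
    (\<lambda>g. proj_point (affine_point r g)) ` affine_solutions r"
proof (intro equalityI subsetI)
  let ?p = "homogenize (hypersurface_poly r e \<epsilon>)"
  fix P assume P: "P \<in> hypersurface r e \<epsilon> - hyperplane_at_infinity r"
  then obtain v where v: "P = proj_point v" "v \<in> carrier_vec (r + 1)"
    by (auto simp: hypersurface_def zero_locus_def PG_def)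
  obtain X where X: "X \<in> P" "X $ 0 \<noteq> 0"
    using P by (auto simp: hypersurface_def zero_locus_def hyperplane_at_infinity_def)
  have v0: "v $ 0 \<noteq> 0"
    using X v by (auto simp: proj_point_def)
  define g where "g = restrict (\<lambda>i. v $ i / v $ 0) (insert r {1..<r})"
  have "poly_eval (\<lambda>i. v $ i) ?p = 0"
    using P v(1) proj_point_self by (auto simp: hypersurface_def zero_locus_def)
  then have "g \<in> affine_solutions r"
    using poly_eval_homogenize_hypersurface_poly[OF r, of "\<lambda>i. v $ i"] v0 by (simp add: g_def)
  moreover have av: "v = v $ 0 \<cdot>\<^sub>v affine_point r g"
    using v(2) v0 r by (intro eq_vecI) (auto simp: affine_point_def g_def)
  have "proj_point v = proj_point (affine_point r g)"
  proof -
    have "proj_point (c \<cdot>\<^sub>v w) = proj_point w" if "c \<noteq> 0" for c and w :: "'a vec"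
    proof (intro equalityI subsetI)
      fix Y assume "Y \<in> proj_point w"
      then obtain d where "d \<noteq> 0" "Y = d \<cdot>\<^sub>v w"
        by (auto simp: proj_point_def)
      then show "Y \<in> proj_point (c \<cdot>\<^sub>v w)"
        using that by (auto simp: proj_point_def smult_smult_assoc intro!: exI[of _ "d / c"])
    qed (use that in \<open>auto simp: proj_point_def smult_smult_assoc\<close>)
    then show ?thesis
      using av v0 by metis
  qed
  ultimately show "P \<in> (\<lambda>g. proj_point (affine_point r g)) ` affine_solutions r"
    using v(1) by blast
next
  let ?p = "homogenize (hypersurface_poly r e \<epsilon>)"
  fix P assume "P \<in> (\<lambda>g. proj_point (affine_point r g)) ` affine_solutions r"
  then obtain g where g: "g \<in> affine_solutions r" "P = proj_point (affine_point r g)"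
    by blast
  have "affine_point r g \<noteq> 0\<^sub>v (r + 1)"
    using affine_point_index(1)[of r g] by (metis index_zero_vec(1) zero_less_Suc Suc_eq_plus1 zero_neq_one)
  then have "P \<in> PG r"
    using g(2) by (auto simp: PG_def)
  moreover have "X $ 0 \<noteq> 0 \<and> poly_eval (\<lambda>i. X $ i) ?p = 0" if "X \<in> P" for X
  proof -
    have "X \<in> proj_point (affine_point r g)"
      using that g(2) by simp
    then obtain c where c: "c \<noteq> 0" "X = c \<cdot>\<^sub>v affine_point r g"
      by (auto simp: proj_point_def)
    have Xi: "X $ i = c * (if i = 0 then 1 else g i)" if "i \<le> r" for i
      using that c by (simp add: affine_point_def)
    have "restrict (\<lambda>i. X $ i / X $ 0) (insert r {1..<r}) = g"
    proof (rule ext)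
      fix i
      show "restrict (\<lambda>i. X $ i / X $ 0) (insert r {1..<r}) i = g i"
        using g(1) c(1) r Xi[of 0] Xi[of i]
        by (auto simp: affine_solutions_def PiE_def extensional_def restrict_def)
    qed
    then show ?thesis
      using poly_eval_homogenize_hypersurface_poly[OF r, of "\<lambda>i. X $ i"] g(1) c(1) Xi[of 0] by simp
  qed
  ultimately show "P \<in> hypersurface r e \<epsilon> - hyperplane_at_infinity r"
    using proj_point_self[of "affine_point r g"] g(2)
    by (auto simp: hypersurface_def zero_locus_def hyperplane_at_infinity_def)
qed

text \<open>Coordinate 0 equals 1 on both sides, which forces the proportionality factor to be
  1.\<close>

lemma inj_on_affine_points:
  assumes r: "r \<ge> 1"
  shows "inj_on (\<lambda>g. proj_point (affine_point r g)) (affine_solutions r)"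
proof (rule inj_onI)
  fix g g' assume g: "g \<in> affine_solutions r" "g' \<in> affine_solutions r"
    and eq: "proj_point (affine_point r g) = proj_point (affine_point r g')"
  obtain c where c: "affine_point r g = c \<cdot>\<^sub>v affine_point r g'"
    using eq proj_point_self[of "affine_point r g"] by (auto simp: proj_point_def)
  have ci: "affine_point r g $ i = c * affine_point r g' $ i" if "i \<le> r" for i
    unfolding c using that by (simp add: affine_point_def)
  have "c = 1"
    using ci[of 0] by simp
  show "g = g'"
  proof (rule PiE_ext)
    show "g \<in> insert r {1..<r} \<rightarrow>\<^sub>E UNIV" "g' \<in> insert r {1..<r} \<rightarrow>\<^sub>E UNIV"
      using g by (auto simp: affine_solutions_def)
    show "g i = g' i" if "i \<in> insert r {1..<r}" for i
      using ci[of i] \<open>c = 1\<close> that r by auto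
  qed
qed

lemma scalar_prod_affine_point:
  assumes r: "r \<ge> 1" and y: "y \<in> carrier_vec (r + 1)"
  shows "affine_point r g \<bullet> y = y $ 0 + (\<Sum>k\<in>insert r {1..<r}. y $ k * g k)"
proof -
  have "{0..<r + 1} = insert 0 (insert r {1..<r})"
    using r by auto
  then have "affine_point r g \<bullet> y = affine_point r g $ 0 * y $ 0 +
      (\<Sum>k\<in>insert r {1..<r}. affine_point r g $ k * y $ k)"
    using r by (simp add: scalar_prod_def carrier_vecD[OF y] del: sum.insert)
  also have "(\<Sum>k\<in>insert r {1..<r}. affine_point r g $ k * y $ k) = (\<Sum>k\<in>insert r {1..<r}. y $ k * g k)"
    using r by (intro sum.cong) auto
  finally show ?thesis
    by simp
qed

text \<open>Points off the hyperplane are counted as a complement; the point at infinity is off it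
  exactly when the last coefficient is nonzero, and then counts \<open>j\<close> times.\<close>

lemma size_filter_hypersurface_mset:
  assumes r: "r \<ge> 1" and y: "y \<in> carrier_vec (r + 1)"
  shows "int (size {#P \<in># hypersurface_mset r e \<epsilon> j. \<exists>X\<in>P. X \<bullet> y \<noteq> 0#}) =
    int q ^ (2 * r - 1)
      - int (card {g \<in> affine_solutions r. y $ 0 + (\<Sum>k\<in>insert r {1..<r}. y $ k * g k) = 0})
      + (if y $ r = 0 then 0 else int j)"
proof -
  let ?A = "affine_solutions r" and ?f = "\<lambda>g. proj_point (affine_point r g)"
  let ?Q = "\<lambda>P. \<exists>X\<in>P. X \<bullet> y \<noteq> 0" and ?Z = "{g \<in> affine_solutions r. affine_point r g \<bullet> y = 0}"
  have fin: "finite ?A"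
    using card_affine_solutions[OF r] q_ge_2 by (intro card_ge_0_finite) simp
  have Q: "?Q (proj_point v) \<longleftrightarrow> v \<bullet> y \<noteq> 0" if "v \<in> carrier_vec (r + 1)" for v
    using that y proj_point_self[of v] by (auto simp: proj_point_def)
  have "?Q (proj_point (affine_point r g)) \<longleftrightarrow> affine_point r g \<bullet> y \<noteq> 0" for g
    by (rule Q) simp
  then have "{P \<in> ?f ` ?A. ?Q P} = ?f ` (?A - ?Z)"
    by (simp add: Setcompr_eq_image conj_commute cong: conj_cong) blast
  moreover have "inj_on ?f (?A - ?Z)"
    using inj_on_affine_points[OF r] by (rule inj_on_subset) auto
  ultimately have "card {P \<in> ?f ` ?A. ?Q P} = card (?A - ?Z)"
    by (simp add: card_image)
  also have "int \<dots> = int (card ?A) - int (card ?Z)"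
    using fin by (subst card_Diff_subset) (auto intro!: of_nat_diff card_mono)
  also have "card ?A = q ^ (2 * r - 1)"
    by (rule card_affine_solutions[OF r])
  finally have "int (card {P \<in> ?f ` ?A. ?Q P}) = int q ^ (2 * r - 1) - int (card ?Z)"
    by simp
  moreover have "?Q (point_at_infinity r) \<longleftrightarrow> y $ r \<noteq> 0"
    unfolding point_at_infinity_def using y by (subst Q) (auto simp: scalar_prod_left_unit)
  moreover have "filter_mset ?Q (replicate_mset j P) = (if ?Q P then replicate_mset j P else {#})" for P
    by (induction j) auto
  ultimately show ?thesis
    using fin by (simp add: hypersurface_mset_def affine_points_hypersurface[OF r]
        scalar_prod_affine_point[OF r y])
qed

lemma size_hypersurface_mset:
  assumes r: "r \<ge> 1"
  shows "size (hypersurface_mset r e \<epsilon> j) = q ^ (2 * r - 1) + j"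
  using card_affine_solutions[OF r] card_image[OF inj_on_affine_points[OF r]]
  by (simp add: hypersurface_mset_def affine_points_hypersurface[OF r])

section \<open>Weights according to the type of the hyperplane\<close>

definition weight :: "nat \<Rightarrow> nat \<Rightarrow> 'a vec \<Rightarrow> nat" where
  "weight r j y = size {#P \<in># hypersurface_mset r e \<epsilon> j. \<exists>X\<in>P. X \<bullet> y \<noteq> 0#}"

lemma weight_hyperplane_at_infinity:
  assumes "r \<ge> 1" and y: "y \<in> carrier_vec (r + 1)"
    and y0: "y $ 0 \<noteq> 0" and yk: "\<And>k. k \<in> insert r {1..<r} \<Longrightarrow> y $ k = 0"
  shows "int (weight r j y) = int q ^ (2 * r - 1)"
proof -
  have "(\<Sum>k\<in>insert r {1..<r}. y $ k * g k) = 0" for g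
    using yk by (intro sum.neutral) auto
  then have Z: "{g \<in> affine_solutions r. y $ 0 + (\<Sum>k\<in>insert r {1..<r}. y $ k * g k) = 0} = {}"
    using y0 by (simp del: sum.insert)
  then show ?thesis
    unfolding weight_def size_filter_hypersurface_mset[OF assms(1) y] Z using yk[of r] by simp
qed

lemma weight_vertical:
  assumes "y \<in> carrier_vec (r + 1)" "y $ r = 0" "i \<in> {1..<r}" "y $ i \<noteq> 0"
  shows "int (weight r j y) = int q ^ (2 * r - 1) - int q ^ (2 * r - 3)"
  using size_filter_hypersurface_mset[of r y] card_affine_solutions_vertical[of "\<lambda>k. y $ k" r i] assms
  by (simp add: weight_def del: sum.insert)

text \<open>The exceptional value depends only on the ratios \<open>m\<close>. Choosing it before
  \<open>y\<close> leaves the constant coefficient free, so that both weights can later be realized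
  with the same \<open>m\<close>.\<close>

lemma weight_oblique:
  assumes r: "r \<ge> 2"
  shows "\<exists>c\<in>K. \<forall>y. y \<in> carrier_vec (r + 1) \<longrightarrow> y $ r \<noteq> 0 \<longrightarrow> (\<forall>k\<in>{1..<r}. y $ k / y $ r = m k) \<longrightarrow>
    int (weight r j y) = int q ^ (2 * r - 1) - int q ^ (2 * r - 3) + (- 1) ^ (r - 1) * int q ^ (r - 2)
      - (if tr (y $ 0 / y $ r) = c then (- 1) ^ (r - 1) * int q ^ (r - 1) else 0) + int j"
proof -
  define D where "D t = {g \<in> {1..<r} \<rightarrow>\<^sub>E UNIV. (\<Sum>k\<in>{1..<r}. Gamma e \<epsilon> (g k) + tr (m k * g k)) = t}" for t
  obtain c where c: "c \<in> K" and D: "\<And>t. t \<in> K \<Longrightarrow> int q * int (card (D t)) =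
      int q ^ (2 * (r - 1)) + (-1) ^ (r - 1) * ((if t = c then int q ^ (r - 1 + 1) else 0) - int q ^ (r - 1))"
    using card_sum_Gamma_plus_linear[of "{1..<r}" m] unfolding D_def by auto
  \<comment> \<open>Removes the truncated subtractions from the exponents, so that a factor q can be
    split off and cancelled.\<close>
  obtain n where "r = n + 2"
    using r le_Suc_ex add.commute by metis
  then have n: "2 * (r - 1) = 2 * n + 2" "2 * r - 3 = 2 * n + 1" "r - 1 = n + 1" "r - 2 = n"
    by auto
  have qD: "int q * int (card (D t)) = int q * (int q ^ (2 * r - 3)
      + (-1) ^ (r - 1) * ((if t = c then int q ^ (r - 1) else 0) - int q ^ (r - 2)))" if "t \<in> K" for t
    using D[OF that] unfolding n by (cases "t = c") (simp_all add: algebra_simps)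
  have D': "int (card (D t)) = int q ^ (2 * r - 3)
      + (-1) ^ (r - 1) * ((if t = c then int q ^ (r - 1) else 0) - int q ^ (r - 2))" if "t \<in> K" for t
    by (rule mult_left_cancel[THEN iffD1, OF _ qD[OF that]]) (use q_ge_2 in simp)
  have "int (weight r j y) = int q ^ (2 * r - 1) - int q ^ (2 * r - 3) + (- 1) ^ (r - 1) * int q ^ (r - 2)
      - (if tr (y $ 0 / y $ r) = c then (- 1) ^ (r - 1) * int q ^ (r - 1) else 0) + int j"
    if y: "y \<in> carrier_vec (r + 1)" "y $ r \<noteq> 0" "\<forall>k\<in>{1..<r}. y $ k / y $ r = m k" for y
  proof -
    have "(\<Sum>k\<in>{1..<r}. Gamma e \<epsilon> (g k) + tr (y $ k / y $ r * g k)) =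
        (\<Sum>k\<in>{1..<r}. Gamma e \<epsilon> (g k) + tr (m k * g k))" for g
      using y(3) by (intro sum.cong) auto
    then have "card {g \<in> affine_solutions r. y $ 0 + (\<Sum>k\<in>insert r {1..<r}. y $ k * g k) = 0} =
        card (D (tr (y $ 0 / y $ r)))"
      unfolding D_def using card_affine_solutions_oblique[of "\<lambda>k. y $ k" r] y(2)
      by (simp del: sum.insert)
    then have "int (weight r j y) = int q ^ (2 * r - 1) - int (card (D (tr (y $ 0 / y $ r)))) + int j"
      using size_filter_hypersurface_mset[of r y j] r y(1,2) by (simp add: weight_def del: sum.insert)
    then show ?thesis
      unfolding D'[OF tr_in_K] by (cases "tr (y $ 0 / y $ r) = c") (simp_all add: algebra_simps)
  qed
  then show ?thesis
    using c by blast
qed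

lemma weights_eq:
  fixes j :: nat
  assumes r: "r \<ge> 2"
  shows "(\<lambda>y. int (weight r j y)) ` (carrier_vec (r + 1) - {0\<^sub>v (r + 1)}) =
    {int q ^ (2 * r - 1),
     int q ^ (2 * r - 1) - int q ^ (2 * r - 3),
     int q ^ (2 * r - 1) - int q ^ (2 * r - 3) + (- 1) ^ (r - 1) * int q ^ (r - 2) + int j,
     int q ^ (2 * r - 1) - int q ^ (2 * r - 3) + (- 1) ^ (r - 1) * int q ^ (r - 2)
       - (- 1) ^ (r - 1) * int q ^ (r - 1) + int j}"
    (is "?L = {?w1, ?w2, ?w3, ?w4}")
proof (intro equalityI subsetI)
  fix w assume "w \<in> ?L"
  then obtain y where y: "y \<in> carrier_vec (r + 1)" "y \<noteq> 0\<^sub>v (r + 1)" and w: "w = int (weight r j y)"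
    by blast
  \<comment> \<open>The hyperplane misses the point at infinity, or passes through it without being
    the hyperplane at infinity, or is that hyperplane.\<close>
  consider "y $ r \<noteq> 0" | i where "y $ r = 0" "i \<in> {1..<r}" "y $ i \<noteq> 0"
    | "\<And>k. k \<in> insert r {1..<r} \<Longrightarrow> y $ k = 0"
    by blast
  then show "w \<in> {?w1, ?w2, ?w3, ?w4}"
  proof cases
    case 1
    then show ?thesis
      using weight_oblique[OF r, of "\<lambda>k. y $ k / y $ r" j] y(1) w by (auto split: if_splits)
  next
    case 2
    then show ?thesis
      using weight_vertical y(1) w by auto
  next
    case 3
    have "y $ 0 \<noteq> 0"
    proof
      assume "y $ 0 = 0"
      have "y $ i = 0" if "i < r + 1" for i
        using that \<open>y $ 0 = 0\<close> 3[of i] by (cases "i = 0"; cases "i = r") auto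
      then have "y = 0\<^sub>v (r + 1)"
        using y(1) by (intro eq_vecI) auto
      then show False
        using y(2) by contradiction
    qed
    then show ?thesis
      using weight_hyperplane_at_infinity[of r y j] 3 y(1) r w by auto
  qed
next
  fix w assume w: "w \<in> {?w1, ?w2, ?w3, ?w4}"
  have vecs: "y \<in> carrier_vec (r + 1) - {0\<^sub>v (r + 1)}" if "y \<in> carrier_vec (r + 1)" "i \<le> r" "y $ i \<noteq> 0"
    for y :: "'a vec" and i
    using that by auto
  have "?w1 \<in> ?L"
  proof
    let ?y = "unit_vec (r + 1) 0 :: 'a vec"
    show "?w1 = int (weight r j ?y)"
      using r by (intro weight_hyperplane_at_infinity[symmetric]) auto
    show "?y \<in> carrier_vec (r + 1) - {0\<^sub>v (r + 1)}"
      by (rule vecs[of _ 0]) auto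
  qed
  moreover have "?w2 \<in> ?L"
  proof
    let ?y = "unit_vec (r + 1) 1 :: 'a vec"
    show "?w2 = int (weight r j ?y)"
      using r by (intro weight_vertical[of _ _ 1, symmetric]) auto
    show "?y \<in> carrier_vec (r + 1) - {0\<^sub>v (r + 1)}"
      using r by (intro vecs[of _ 1]) auto
  qed
  moreover have "?w3 \<in> ?L \<and> ?w4 \<in> ?L"
  proof -
    obtain c where c: "c \<in> K" and W: "\<And>y. y \<in> carrier_vec (r + 1) \<Longrightarrow> y $ r \<noteq> 0 \<Longrightarrow>
        (\<forall>k\<in>{1..<r}. y $ k / y $ r = 0) \<Longrightarrow>
        int (weight r j y) = int q ^ (2 * r - 1) - int q ^ (2 * r - 3) + (- 1) ^ (r - 1) * int q ^ (r - 2)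
          - (if tr (y $ 0 / y $ r) = c then (- 1) ^ (r - 1) * int q ^ (r - 1) else 0) + int j"
      using weight_oblique[OF r, of "\<lambda>_. 0" j] by blast
    define y where "y s = vec (r + 1) (\<lambda>i. if i = 0 then s else if i = r then 1 else 0 :: 'a)" for s
    have y: "y s \<in> carrier_vec (r + 1)" "y s $ 0 = s" "y s $ r = 1" "\<forall>k\<in>{1..<r}. y s $ k / y s $ r = 0" for s
      using r by (auto simp: y_def)
    have y_vec: "y s \<in> carrier_vec (r + 1) - {0\<^sub>v (r + 1)}" for s
      using y by (intro vecs[of _ r]) auto
    have Wy: "int (weight r j (y s)) = (if tr s = c then ?w4 else ?w3)" for s
      using W[OF y(1) _ y(4), of s] y(2,3)[of s] by simp
    \<comment> \<open>Since \<open>tr\<close> is onto \<open>K\<close>, the constant coefficient can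
      be chosen to hit the exceptional value or to miss it, with c + 1 as a value different from
      c.\<close>
    obtain s where "tr s = c"
      using c range_tr by (metis rangeE)
    moreover obtain s' where "tr s' = c + 1"
      using c range_tr K_closed(2,3) by (metis rangeE)
    ultimately have "int (weight r j (y s)) = ?w4" "int (weight r j (y s')) = ?w3"
      by (simp_all add: Wy)
    then show ?thesis
      using y_vec[of s] y_vec[of s'] by (metis (no_types, lifting) imageI)
  qed
  ultimately show "w \<in> ?L"
    using w by (auto simp del: Diff_iff)
qed

text \<open>Makes the encoding map injective, from which the dimension of the code follows.\<close>

lemma weight_pos:
  assumes r: "r \<ge> 2" and y: "y \<in> carrier_vec (r + 1)" "y \<noteq> 0\<^sub>v (r + 1)"
  shows "weight r j y > 0"
proof -
  define a where "a = int q ^ (r - 2)"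
  have q: "int q \<ge> 2"
    using q_ge_2 by simp
  have a: "a \<ge> 1"
    using q by (simp add: a_def)
  have "2 * r - 3 = Suc (2 * (r - 2))" "2 * r - 1 = Suc (Suc (Suc (2 * (r - 2))))" "r - 1 = Suc (r - 2)"
    using r by auto
  then have pow: "int q ^ (2 * r - 3) = int q * a\<^sup>2" "int q ^ (2 * r - 1) = int q ^ 3 * a\<^sup>2"
    "int q ^ (r - 1) = int q * a"
    by (simp_all add: a_def power_even_eq numeral_3_eq_3)
  have "int q * a * 1 \<le> int q * a * a" "2 * a \<le> int q * a"
    using q a by (intro mult_left_mono mult_right_mono; simp)+
  moreover have "4 * (int q * a\<^sup>2) \<le> (int q)\<^sup>2 * (int q * a\<^sup>2)"
    using q power_mono[of 2 "int q" 2] by (intro mult_right_mono) auto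
  ultimately have bounds: "int q * a \<le> int q * a\<^sup>2" "2 * a \<le> int q * a" "4 * (int q * a\<^sup>2) \<le> int q ^ 3 * a\<^sup>2"
    by (simp_all add: power2_eq_square power3_eq_cube mult_ac)
  define x z u where "x = int q * a\<^sup>2" and "z = int q ^ 3 * a\<^sup>2" and "u = int q * a"
  have "int (weight r j y) \<in> {int q ^ 3 * a\<^sup>2, int q ^ 3 * a\<^sup>2 - int q * a\<^sup>2,
      int q ^ 3 * a\<^sup>2 - int q * a\<^sup>2 + (-1) ^ (r - 1) * a + int j,
      int q ^ 3 * a\<^sup>2 - int q * a\<^sup>2 + (-1) ^ (r - 1) * a - (-1) ^ (r - 1) * (int q * a) + int j}"
    using weights_eq[OF r, of j] y unfolding pow a_def[symmetric] by blast
  \<comment> \<open>Listing the values for both signs, in terms of opaque monomials, leaves only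
    linear inequalities that follow from \<open>bounds\<close>.\<close>
  then have "int (weight r j y) \<in> {z, z - x, z - x + a + int j, z - x + a - u + int j,
      z - x - a + int j, z - x - a + u + int j}"
    unfolding x_def z_def u_def by (cases "even (r - 1)") auto
  then have "int (weight r j y) > 0"
    using bounds a unfolding x_def[symmetric] z_def[symmetric] u_def[symmetric] by auto
  then show ?thesis
    by simp
qed

end

text \<open>Here a, b, x, z stand for q^(r-2), q^(r-1), q^(2r-3), q^(2r-1), and the two claims for
  the two signs. Each listed \<open>j\<close> makes one of the last two weights coincide with z or z
  - x, and the ordering keeps the remaining three apart.\<close>

lemma card_weight_set_eq_3:
  fixes a b x z j :: int
  assumes "0 < a" "a < b" "b < x"
  shows "j \<in> {b - a, x - a, x + b - a} \<Longrightarrow> card {z, z - x, z - x + a + j, z - x + a - b + j} = 3"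
    and "j \<in> {a, x + a, x - b + a} \<Longrightarrow> card {z, z - x, z - x - a + j, z - x - a + b + j} = 3"
  using assms by (auto simp: card_insert_if)

theorem theorem3p13:
  fixes r e q j :: nat
    and \<epsilon> \<delta> :: "'a::{field,finite}"
    and C :: "'a vec set"
  assumes "r \<ge> 3" and "e \<ge> 3" and "odd e" and "q = 2 ^ e"
    and "CARD('a) = q ^ 2"
    and "\<delta> \<in> subfield_of_order q" and "\<delta> \<noteq> 1" and "abs_trace e \<delta> = 1"
    and "\<epsilon> \<notin> subfield_of_order q" and "\<epsilon> ^ 2 + \<epsilon> + \<delta> = 0"
    and "j \<ge> 1"
    and "associated_code r (hypersurface_mset r e \<epsilon> j) C"
  shows "linear_code (q ^ (2 * r - 1) + j) (r + 1) C
    \<and> int ` code_weights C =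
        {int q ^ (2 * r - 1),
         int q ^ (2 * r - 1) - int q ^ (2 * r - 3),
         int q ^ (2 * r - 1) - int q ^ (2 * r - 3)
           + (- 1) ^ (r - 1) * int q ^ (r - 2) + int j,
         int q ^ (2 * r - 1) - int q ^ (2 * r - 3)
           + (- 1) ^ (r - 1) * int q ^ (r - 2) - (- 1) ^ (r - 1) * int q ^ (r - 1) + int j}
    \<and> (odd r \<and>
         (int j = int q ^ (r - 1) - int q ^ (r - 2) \<or>
          int j = int q ^ (2 * r - 3) - int q ^ (r - 2) \<or>
          int j = int q ^ (2 * r - 3) + int q ^ (r - 1) - int q ^ (r - 2))
       \<or> even r \<and>
         (int j = int q ^ (r - 2) \<or>
          int j = int q ^ (2 * r - 3) + int q ^ (r - 2) \<or>
          int j = int q ^ (2 * r - 3) - int q ^ (r - 1) + int q ^ (r - 2))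
       \<longrightarrow> card (code_weights C) = 3)"
proof -
  interpret quadratic_ext_char_2 e q \<epsilon> \<delta>
    using assms by unfold_locales
  have r: "r \<ge> 1" "r \<ge> 2"
    using assms(1) by auto
  let ?M = "hypersurface_mset r e \<epsilon> j"
  obtain ps G where ps: "mset ps = ?M" and G: "G \<in> carrier_mat (r + 1) (length ps)"
    and col: "\<And>i. i < length ps \<Longrightarrow> col G i \<in> ps ! i"
    and C: "C = vec_space.row_space (length ps) G"
    using assms(12) unfolding associated_code_def by blast
  have len: "length ps = q ^ (2 * r - 1) + j"
    using size_hypersurface_mset[OF r(1), of j] by (simp flip: ps)
  have "set ps \<subseteq> PG r"
    using hypersurface_mset_subset[of r e \<epsilon> j] by (simp flip: ps)
  then have hw: "hamming_weight (G\<^sup>T *\<^sub>v y) = weight r j y" if "y \<in> carrier_vec (r + 1)" for y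
    using hamming_weight_codeword[OF G col _ that] by (simp add: weight_def ps)
  have zero: "hamming_weight (0\<^sub>v n :: 'a vec) = 0" for n
    by (auto simp: hamming_weight_def)
  \<comment> \<open>A nonzero message encoded as the zero word would have weight 0, against
    \<open>weight_pos\<close>.\<close>
  have nz: "G\<^sup>T *\<^sub>v y \<noteq> 0\<^sub>v (length ps)" if "y \<in> carrier_vec (r + 1)" "y \<noteq> 0\<^sub>v (r + 1)" for y
  proof
    assume "G\<^sup>T *\<^sub>v y = 0\<^sub>v (length ps)"
    then have "weight r j y = 0"
      using hw[OF that(1)] zero by (simp del: index_zero_vec)
    then show False
      using weight_pos[OF r(2) that, of j] by simp
  qed
  have code: "linear_code (q ^ (2 * r - 1) + j) (r + 1) C"
    unfolding C len[symmetric] using G nz by (intro linear_code_row_space) auto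
  have "C = (\<lambda>y. G\<^sup>T *\<^sub>v y) ` carrier_vec (r + 1)"
    unfolding C vec_space.row_space_eq[OF G] using G by auto
  moreover have G0: "G\<^sup>T *\<^sub>v 0\<^sub>v (r + 1) = 0\<^sub>v (length ps)"
    using G by (intro eq_vecI) auto
  ultimately have "{c \<in> C. c \<noteq> 0\<^sub>v (dim_vec c)} = (\<lambda>y. G\<^sup>T *\<^sub>v y) ` (carrier_vec (r + 1) - {0\<^sub>v (r + 1)})"
    using G nz G0 by auto
  then have "code_weights C = weight r j ` (carrier_vec (r + 1) - {0\<^sub>v (r + 1)})"
    unfolding code_weights_def by (auto simp: image_image hw)
  then have weights: "int ` code_weights C =
        {int q ^ (2 * r - 1),
         int q ^ (2 * r - 1) - int q ^ (2 * r - 3),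
         int q ^ (2 * r - 1) - int q ^ (2 * r - 3)
           + (- 1) ^ (r - 1) * int q ^ (r - 2) + int j,
         int q ^ (2 * r - 1) - int q ^ (2 * r - 3)
           + (- 1) ^ (r - 1) * int q ^ (r - 2) - (- 1) ^ (r - 1) * int q ^ (r - 1) + int j}"
    (is "_ = ?W")
    using weights_eq[OF r(2), of j] by (simp add: image_image)
  have "card (code_weights C) = card ?W"
    unfolding weights[symmetric] by (simp add: card_image)
  have q: "int q > 1"
    using q_ge_2 by simp
  \<comment> \<open>The second inequality compares r - 1 with 2r - 3, which is where r >= 3 rather
    than r >= 2 enters.\<close>
  have lt: "int q ^ (r - 2) < int q ^ (r - 1)" "int q ^ (r - 1) < int q ^ (2 * r - 3)"
    "int q ^ (r - 2) > 0"
    using q assms(1) by (auto intro!: power_strict_increasing)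
  have three: "card (code_weights C) = 3"
    if "odd r \<and>
         (int j = int q ^ (r - 1) - int q ^ (r - 2) \<or>
          int j = int q ^ (2 * r - 3) - int q ^ (r - 2) \<or>
          int j = int q ^ (2 * r - 3) + int q ^ (r - 1) - int q ^ (r - 2))
       \<or> even r \<and>
         (int j = int q ^ (r - 2) \<or>
          int j = int q ^ (2 * r - 3) + int q ^ (r - 2) \<or>
          int j = int q ^ (2 * r - 3) - int q ^ (r - 1) + int q ^ (r - 2))"
  proof -
    have "card ?W = 3"
    proof (cases "odd r")
      case True
      then have "(- 1 :: int) ^ (r - 1) = 1"
        by simp
      then show ?thesis
        using card_weight_set_eq_3(1)[OF lt(3,1,2), of "int j"] that True
        by (simp only: mult_1) blast
    next
      case False
      then have "(- 1 :: int) ^ (r - 1) = - 1"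
        using r(1) by simp
      then show ?thesis
        using card_weight_set_eq_3(2)[OF lt(3,1,2), of "int j"] that False
        by (simp only: mult_minus1 add_uminus_conv_diff diff_minus_eq_add) blast
    qed
    then show ?thesis
      using \<open>card (code_weights C) = card ?W\<close> by simp
  qed
  show ?thesis
    using code weights three by blast
qed

end
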